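(* Let $G$ be a locally compact unimodular amenable topological group and let $T : G \curvearrowright X$ be a continuous action of $G$ on a compact metrizable space $X$. Let $\mu \in \mathcal{M}_T(X)$ be a $T$-invariant Borel probability measure on $X$, and let $(F_k)_{k=1}^\infty$ be a Følner sequence for $G$. Let $f \in C(X)$ (complex-valued). Consider the conditions: (1) $f$ is Herman, i.e. the set $\{ \int f \, \mathrm{d}\nu : \nu \in \mathcal{M}_T(X)\}$ is a singleton. (2) For every sequence $(C_k)_{k=1}^\infty$ of Borel-measurable subsets of $X$ of positive $\mu$-measure, the sequence $\left( \alpha_{C_k}\left( \operatorname{Avg}_{F_k} f\right)\right)_{k=1}^\infty$ converges to $\int f \, \mathrm{d}\mu$. (3) For every sequence $(U_k)_{k=1}^\infty$ of open subsets of $X$ of positive $\mu$-measure, the sequence $\left( \alpha_{U_k}\left( \operatorname{Avg}_{F_k} f\right)\right)_{k=1}^\infty$ converges to $\int f \, \mathrm{d}\mu$. (4) For every sequence $(U_k)_{k=1}^\infty$ of open subsets of $X$ of positive $\mu$-measure, the sequence $\left( \alpha_{U_k}\left( \operatorname{Avg}_{F_k} f\right)\right)_{k=1}^\infty$ converges to some complex number. Then (1)$\Rightarrow$(2)$\Rightarrow$(3)$\Rightarrow$(4), and if $\mu$ is fully supported on $X$ (gives positive measure to every nonempty open set), then (4)$\Rightarrow$(1). Furthermore, if $\{ \int f \, \mathrm{d}\nu : \nu \in \mathcal{M}_T(X)\}$ is not a singleton, $\mu$ is fully supported, and $(X,\mu)$ is atomless, then there exists a sequence $(U_k')_{k=1}^\infty$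 of open subsets of $X$ of positive measure such that $\left( \alpha_{U_k'}\left( \operatorname{Avg}_{F_k} f\right)\right)_{k=1}^\infty$ diverges and $\mu(U_k') \searrow 0$ (i.e. $\mu(U_k')$ is non-increasing in $k$ with limit $0$).
   Context: $\mathcal{M}_T(X)$ denotes the set of $T$-invariant Borel probability measures on $X$. $m$ is a bi-invariant Haar measure on $G$. For a compact $K \subseteq G$ with $m(K)>0$ and $f \in C(X)$, $\operatorname{Avg}_K f(x) = \frac{1}{m(K)} \int_K f(T_g x) \, \mathrm{d}m(g)$, a continuous function on $X$. For a measurable $C \subseteq X$ with $\mu(C)>0$, $\alpha_C(h) = \frac{1}{\mu(C)} \int_C h \, \mathrm{d}\mu$. A sequence $(F_k)_{k=1}^\infty$ of compact subsets of $G$ is Følner if $m(F_k)>0$ for all $k$ and $\lim_{k} \frac{m(gF_k \,\Delta\, F_k)}{m(F_k)} = 0$ for every $g \in G$. The action convention is $T_{gh} = T_g T_h$. *)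

theory Defs
  imports "HOL-Analysis.Analysis" "HOL-Probability.Probability_Measure"
begin

text \<open>
  Topological groups are written additively, as instances of the library class
  topological_group_add, which does not assume commutativity: the sum \<open>g + h\<close> is the product
  of \<open>g\<close> and \<open>h\<close>, and \<open>0\<close> is the identity.
\<close>

definition left_haar_measure :: "'g::topological_group_add measure \<Rightarrow> bool" where
  "left_haar_measure m \<longleftrightarrow>
     sets m = sets borel \<and>
     emeasure m UNIV \<noteq> 0 \<and>
     (\<forall>K. compact K \<longrightarrow> emeasure m K < \<infinity>) \<and>
     (\<forall>A\<in>sets borel. emeasure m A = (INF U\<in>{U. open U \<and> A \<subseteq> U}. emeasure m U)) \<and>
     (\<forall>U. open U \<longrightarrow> emeasure m U = (SUP K\<in>{K. compact K \<and> K \<subseteq> U}. emeasure m K)) \<and>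
     (\<forall>g. \<forall>A\<in>sets borel. emeasure m ((\<lambda>x. g + x) ` A) = emeasure m A)"

definition right_invariant_measure :: "'g::topological_group_add measure \<Rightarrow> bool" where
  "right_invariant_measure m \<longleftrightarrow>
     (\<forall>g. \<forall>A\<in>sets borel. emeasure m ((\<lambda>x. x + g) ` A) = emeasure m A)"

definition bi_invariant_haar_measure :: "'g::topological_group_add measure \<Rightarrow> bool" where
  "bi_invariant_haar_measure m \<longleftrightarrow> left_haar_measure m \<and> right_invariant_measure m"

definition unimodular_group :: "'g::topological_group_add itself \<Rightarrow> bool" where
  "unimodular_group _ \<longleftrightarrow>
     (\<forall>m :: 'g measure. left_haar_measure m \<longrightarrow> right_invariant_measure m)"

text \<open>
  Amenability: existence of a left-invariant mean on the bounded continuous real functions.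
\<close>

definition amenable_group :: "'g::topological_group_add itself \<Rightarrow> bool" where
  "amenable_group _ \<longleftrightarrow>
     (\<exists>\<Lambda> :: ('g \<Rightarrow>\<^sub>C real) \<Rightarrow> real.
        linear \<Lambda> \<and>
        \<Lambda> (const_bcontfun 1) = 1 \<and>
        (\<forall>\<phi>. (\<forall>x. 0 \<le> apply_bcontfun \<phi> x) \<longrightarrow> 0 \<le> \<Lambda> \<phi>) \<and>
        (\<forall>g \<phi> \<psi>. (\<forall>x. apply_bcontfun \<psi> x = apply_bcontfun \<phi> (g + x)) \<longrightarrow> \<Lambda> \<psi> = \<Lambda> \<phi>))"

definition folner_sequence ::
    "'g::topological_group_add measure \<Rightarrow> (nat \<Rightarrow> 'g set) \<Rightarrow> bool" where
  "folner_sequence m F \<longleftrightarrow>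
     (\<forall>k. compact (F k) \<and> measure m (F k) > 0) \<and>
     (\<forall>g. (\<lambda>k. measure m (sym_diff ((\<lambda>x. g + x) ` F k) (F k)) / measure m (F k))
            \<longlonglongrightarrow> 0)"

definition continuous_action ::
    "('g::topological_group_add \<Rightarrow> 'x::topological_space \<Rightarrow> 'x) \<Rightarrow> bool" where
  "continuous_action T \<longleftrightarrow>
     (\<forall>x. T 0 x = x) \<and>
     (\<forall>g h x. T (g + h) x = T g (T h x)) \<and>
     continuous_on UNIV (\<lambda>(g, x). T g x)"

definition invariant_measures ::
    "('g \<Rightarrow> 'x::topological_space \<Rightarrow> 'x) \<Rightarrow> 'x measure set" where
  "invariant_measures T =
     {\<nu>. sets \<nu> = sets borel \<and> prob_space \<nu> \<and>
          (\<forall>g. \<forall>A\<in>sets borel. emeasure \<nu> (T g -` A) = emeasure \<nu> A)}"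

definition herman ::
    "('g \<Rightarrow> 'x::topological_space \<Rightarrow> 'x) \<Rightarrow> ('x \<Rightarrow> complex) \<Rightarrow> bool" where
  "herman T f \<longleftrightarrow> is_singleton ((\<lambda>\<nu>. LINT x|\<nu>. f x) ` invariant_measures T)"

definition Avg ::
    "'g measure \<Rightarrow> ('g \<Rightarrow> 'x \<Rightarrow> 'x) \<Rightarrow> 'g set \<Rightarrow> ('x \<Rightarrow> complex) \<Rightarrow> 'x \<Rightarrow> complex" where
  "Avg m T K f x = (LINT g:K|m. f (T g x)) / complex_of_real (measure m K)"

definition alpha :: "'x measure \<Rightarrow> 'x set \<Rightarrow> ('x \<Rightarrow> complex) \<Rightarrow> complex" where
  "alpha \<mu> C h = (LINT x:C|\<mu>. h x) / complex_of_real (measure \<mu> C)"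

definition fully_supported :: "'x::topological_space measure \<Rightarrow> bool" where
  "fully_supported \<mu> \<longleftrightarrow> (\<forall>U. open U \<and> U \<noteq> {} \<longrightarrow> measure \<mu> U > 0)"

definition atomless :: "'x measure \<Rightarrow> bool" where
  "atomless \<mu> \<longleftrightarrow>
     (\<forall>A\<in>sets \<mu>. measure \<mu> A > 0 \<longrightarrow>
        (\<exists>B\<in>sets \<mu>. B \<subseteq> A \<and> 0 < measure \<mu> B \<and> measure \<mu> B < measure \<mu> A))"

end

theory Submission
  imports Defs "HOL-Probability.Helly_Selection"
begin

text \<open>
  For a Herman function, the functional \<open>h \<mapsto> \<alpha>(Avg h)\<close> is integration against the image \<open>M\<^sub>k\<close> of
  the product of normalised Haar measure on \<open>F\<^sub>k\<close> with normalised \<open>\<mu>\<close> on \<open>C\<^sub>k\<close> under the action map.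
  By compactness every subsequence of \<open>M\<^sub>k\<close> has a weak limit point, which the Folner condition makes
  invariant; so it assigns to \<open>f\<close> the one value that all invariant measures share.

  If instead \<open>\<nu>\<close> and \<open>\<mu>\<close> disagree on \<open>f\<close>, then for every \<open>k\<close> the average of \<open>f\<close> along \<open>F\<^sub>k\<close> takes
  values on either side of the gap. Small balls around such points, on alternating sides for even and odd
  \<open>k\<close>, have positive measure by full support and give divergent averages; without atoms their measures
  can be arranged to decrease to zero.
\<close>

section \<open>Weak limits of measures on a compact metric space\<close>

lemma compact_UNIV_imp_finite_ball_covers:
  assumes "compact (UNIV :: 'x::metric_space set)"
  obtains D :: "nat \<Rightarrow> 'x::metric_space set"
  where "\<And>n. finite (D n)" "\<And>n x. \<exists>c\<in>D n. dist c x < 1 / Suc n"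
proof -
  have "\<exists>D. finite D \<and> (\<forall>x::'x. \<exists>c\<in>D. dist c x < 1 / Suc n)" for n
  proof -
    have "0 < 1 / real (Suc n)" by simp
    then obtain D where "finite D" "UNIV \<subseteq> (\<Union>c\<in>D. ball (c::'x) (1 / Suc n))"
      using assms unfolding compact_eq_totally_bounded by blast
    then show ?thesis by (intro exI[of _ D]) (auto simp: subset_iff)
  qed
  then show thesis using that by metis
qed

text \<open>The balls come from enumerating all pairs of a scale \<open>n\<close> and a centre in
  the finite \<open>1 / Suc n\<close>-net. The second property speaks of closed balls because it
  later feeds a compactness argument. The third bounds the index uniformly in \<open>x\<close>, so
  that finitely many balls locate every point up to \<open>e\<close>.\<close>

lemma compact_UNIV_imp_countable_ball_basis:
  assumes "compact (UNIV :: 'x::metric_space set)"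
  obtains c :: "nat \<Rightarrow> 'x::metric_space" and r :: "nat \<Rightarrow> real"
  where "\<And>n. 0 < r n"
    and "\<And>V x. open V \<Longrightarrow> x \<in> V \<Longrightarrow> \<exists>n. x \<in> ball (c n) (r n) \<and> cball (c n) (r n) \<subseteq> V"
    and "\<And>e. 0 < e \<Longrightarrow> \<exists>N. \<forall>x. \<exists>n<N. x \<in> ball (c n) (r n) \<and> r n < e"
proof -
  obtain D :: "nat \<Rightarrow> 'x set" where fin: "\<And>n. finite (D n)"
    and cov: "\<And>n x. \<exists>c\<in>D n. dist c x < 1 / Suc n"
    using compact_UNIV_imp_finite_ball_covers[OF assms] by blast
  define P where "P = (SIGMA n:UNIV. D n)"
  have "countable P" unfolding P_def using fin by (intro countable_SIGMA) (auto intro: countable_finite)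
  define p where "p = from_nat_into P"
  have "P \<noteq> {}" unfolding P_def using cov[of 0] by auto
  have pP: "p n \<in> P" for n unfolding p_def by (rule from_nat_into[OF \<open>P \<noteq> {}\<close>])
  have idx: "p (to_nat_on P q) = q" if "q \<in> P" for q
    unfolding p_def using that \<open>countable P\<close> by simp
  define c where "c n = snd (p n)" for n
  define r where "r n = 1 / real (Suc (fst (p n)))" for n
  show thesis
  proof (rule that[of r c])
    show "0 < r n" for n by (simp add: r_def)
  next
    fix V and x :: 'x assume "open V" "x \<in> V"
    then obtain e where e: "e > 0" "ball x e \<subseteq> V" by (meson openE)
    obtain n where n: "inverse (real (Suc n)) < e / 2"
      using reals_Archimedean[of "e/2"] e by auto
    obtain d where d: "d \<in> D n" "dist d x < 1 / Suc n" using cov by blast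
    define k where "k = to_nat_on P (n, d)"
    have k: "p k = (n, d)" unfolding k_def by (rule idx) (use d in \<open>simp add: P_def\<close>)
    have "cball d (1 / Suc n) \<subseteq> ball x e"
    proof
      fix y assume "y \<in> cball d (1 / Suc n)"
      then have "dist d y \<le> 1 / Suc n" by simp
      moreover have "dist x y \<le> dist d x + dist d y" by (metis dist_commute dist_triangle)
      ultimately show "y \<in> ball x e" using d n by (simp add: inverse_eq_divide)
    qed
    then show "\<exists>n. x \<in> ball (c n) (r n) \<and> cball (c n) (r n) \<subseteq> V"
      using e d k by (intro exI[of _ k]) (auto simp: c_def r_def)
  next
    fix e :: real assume "0 < e"
    then obtain n where n: "inverse (real (Suc n)) < e"
      using reals_Archimedean[of e] by auto
    \<comment> \<open>The net at scale \<open>n\<close> is finite, hence so is the set of indices of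
      its balls. \<open>N\<close> is one more than the largest of them.\<close>
    define N where "N = Suc (Max ((\<lambda>d. to_nat_on P (n, d)) ` D n))"
    show "\<exists>N. \<forall>x. \<exists>n<N. x \<in> ball (c n) (r n) \<and> r n < e"
    proof (rule exI[of _ N], rule allI)
      fix x
      obtain d where d: "d \<in> D n" "dist d x < 1 / Suc n" using cov by blast
      define k where "k = to_nat_on P (n, d)"
      have k: "p k = (n, d)" unfolding k_def by (rule idx) (use d in \<open>simp add: P_def\<close>)
      have "k < N" unfolding N_def k_def less_Suc_eq_le using d fin by (intro Max_ge) auto
      then show "\<exists>n<N. x \<in> ball (c n) (r n) \<and> r n < e"
        using d k n by (intro exI[of _ k]) (auto simp: c_def r_def inverse_eq_divide)
    qed
  qed
qed

section \<open>Coding points by real numbers\<close>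

lemma ternary_expansion_summable:
  "summable (\<lambda>j. (if b j then 1 else 0) * (1/3::real)^j)"
  by (rule summable_comparison_test[where g="\<lambda>j. (1/3)^j"]) auto

text \<open>At the first disagreement \<open>i\<close> the difference series has a term of size
  \<open>(1/3)^i\<close>, and all later terms together have size at most half of that. So the two
  sums differ by at least \<open>(1/3)^i / 2\<close>, which is too much if
  \<open>i < N\<close>.\<close>

lemma ternary_expansion_close_imp_agree:
  fixes a b :: "nat \<Rightarrow> bool"
  assumes "\<bar>(\<Sum>j. (if a j then 1 else 0) * (1/3::real)^j) - (\<Sum>j. (if b j then 1 else 0) * (1/3)^j)\<bar> < (1/3)^N / 2"
    and "j < N"
  shows "a j = b j"
proof (rule ccontr)
  assume ne: "a j \<noteq> b j"
  define i where "i = (LEAST j. a j \<noteq> b j)"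
  have i: "a i \<noteq> b i" "\<And>k. k < i \<Longrightarrow> a k = b k"
    unfolding i_def using ne LeastI[of "\<lambda>j. a j \<noteq> b j"] not_less_Least by blast+
  have "i \<le> j" unfolding i_def using ne by (rule Least_le)
  define d :: "nat \<Rightarrow> real" where "d k = ((if a k then 1 else 0) - (if b k then 1 else 0)) * (1/3)^k" for k
  have sd: "summable d"
    using summable_diff[OF ternary_expansion_summable[of a] ternary_expansion_summable[of b]]
    by (simp add: d_def[abs_def] left_diff_distrib del: if_distrib)
  have eq: "(\<Sum>j. (if a j then 1 else 0) * (1/3::real)^j) - (\<Sum>j. (if b j then 1 else 0) * (1/3)^j) = suminf d"
    unfolding suminf_diff[OF ternary_expansion_summable[of a] ternary_expansion_summable[of b]]
    by (simp add: d_def[abs_def] left_diff_distrib)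
  have "suminf d = (\<Sum>k. d (k + Suc i)) + (\<Sum>k<Suc i. d k)"
    by (rule suminf_split_initial_segment[OF sd])
  also have "(\<Sum>k<Suc i. d k) = d i" by (simp add: i d_def)
  finally have sp: "suminf d = (\<Sum>k. d (k + Suc i)) + d i" .
  have gs: "(\<lambda>k. (1/3::real)^(k + Suc i)) sums ((1/3)^i / 2)"
  proof -
    have "(\<lambda>k. (1/3::real)^Suc i * (1/3)^k) sums ((1/3)^Suc i * (1 / (1 - 1/3)))"
      by (intro sums_mult geometric_sums) simp
    then show ?thesis by (simp add: power_add mult.commute)
  qed
  have db: "\<bar>d k\<bar> \<le> (1/3)^k" for k by (simp add: d_def)
  have "norm (\<Sum>k. d (k + Suc i)) \<le> (\<Sum>k. (1/3)^(k + Suc i))"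
    by (rule norm_suminf_le[OF _ sums_summable[OF gs]]) (simp only: real_norm_def db)
  also have "\<dots> = (1/3)^i / 2" using gs by (simp add: sums_iff)
  finally have tail: "\<bar>\<Sum>k. d (k + Suc i)\<bar> \<le> (1/3)^i / 2" by simp
  have "\<bar>d i\<bar> = (1/3)^i" using i by (auto simp: d_def)
  then have "(1/3)^i / 2 \<le> \<bar>suminf d\<bar>" using tail sp by linarith
  moreover have "(1/3::real)^N \<le> (1/3)^i"
    using \<open>i \<le> j\<close> \<open>j < N\<close> by (intro power_decreasing) auto
  ultimately show False using assms(1) eq by linarith
qed

text \<open>
  A sum of distinct powers of \<open>1/3\<close> determines its digits stably: the first digit in which two such
  sums differ outweighs all later ones by a factor of two. Coding membership in a countable ball basis
  this way yields a Borel embedding into the reals with uniformly continuous inverse.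
\<close>

lemma compact_metric_borel_code:
  assumes "compact (UNIV :: 'x::metric_space set)"
  obtains s :: "'x::metric_space \<Rightarrow> real"
  where "s \<in> borel_measurable borel" "\<And>x. s x \<in> {0..2}"
    and "\<And>e. 0 < e \<Longrightarrow> \<exists>d>0. \<forall>x y. \<bar>s x - s y\<bar> < d \<longrightarrow> dist x y < e"
proof -
  obtain c :: "nat \<Rightarrow> 'x" and r where
    cov: "\<And>e. 0 < e \<Longrightarrow> \<exists>N. \<forall>x. \<exists>n<N. x \<in> ball (c n) (r n) \<and> r n < e"
    using compact_UNIV_imp_countable_ball_basis[OF assms] by metis
  define s where "s x = (\<Sum>j. (if x \<in> ball (c j) (r j) then 1 else 0) * (1/3::real)^j)" for x
  show thesis
  proof
    have [measurable]: "ball (c j) (r j) \<in> sets borel" for j by simp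
    show "s \<in> borel_measurable borel" unfolding s_def by measurable
  next
    fix x
    have "0 \<le> s x" unfolding s_def by (intro suminf_nonneg ternary_expansion_summable) auto
    \<comment> \<open>The full geometric series is 3/2; the bound 2 is rounded up.\<close>
    moreover have "s x \<le> (\<Sum>j. (1/3::real)^j)" unfolding s_def
      by (intro suminf_le ternary_expansion_summable) auto
    ultimately show "s x \<in> {0..2}" by (simp add: suminf_geometric)
  next
    fix e :: real assume "0 < e"
    then obtain N where N: "\<forall>x. \<exists>n<N. x \<in> ball (c n) (r n) \<and> r n < e / 2"
      using cov[of "e/2"] by auto
    show "\<exists>d>0. \<forall>x y. \<bar>s x - s y\<bar> < d \<longrightarrow> dist x y < e"
    proof (intro exI[of _ "(1/3)^N / 2"] conjI allI impI)
      fix x y assume d: "\<bar>s x - s y\<bar> < (1/3)^N / 2"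
      obtain n where n: "n < N" "x \<in> ball (c n) (r n)" "r n < e / 2" using N by blast
      \<comment> \<open>Close codes agree in digit \<open>n\<close>, so \<open>x\<close> and
        \<open>y\<close> lie in the same ball of radius below \<open>e / 2\<close>.\<close>
      have "y \<in> ball (c n) (r n)"
        using ternary_expansion_close_imp_agree[OF d[unfolded s_def] n(1)] n by simp
      then show "dist x y < e" using n dist_triangle_half_r[of "c n" x e y] by simp
    qed simp
  qed
qed

text \<open>The hypothesis on \<open>s\<close> says that its inverse is uniformly continuous on the
  range, and compactness supplies the limits that extend this inverse to the closure. The closure
  matters because \<open>s\<close> is not assumed continuous, so its range need not be
  closed.\<close>

lemma code_decoder:
  fixes s :: "'x::metric_space \<Rightarrow> real"
  assumes X: "compact (UNIV :: 'x set)"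
    and s: "\<And>e. 0 < e \<Longrightarrow> \<exists>d>0. \<forall>x y. \<bar>s x - s y\<bar> < d \<longrightarrow> dist x y < e"
  obtains \<phi> where "continuous_on (closure (range s)) \<phi>" "\<And>x. \<phi> (s x) = x"
proof -
  \<comment> \<open>The decoded value at \<open>y\<close> is a limit of points whose codes tend to
    \<open>y\<close>. It is characterised by codes alone: every point with code near
    \<open>y\<close> is near it. Choosing such a value for each \<open>y\<close> gives
    \<open>\<phi>\<close>.\<close>
  have "\<exists>x. \<forall>e>0. \<exists>d>0. \<forall>z. \<bar>s z - y\<bar> < d \<longrightarrow> dist z x < e" if y: "y \<in> closure (range s)" for y
  proof -
    obtain z where z: "(\<lambda>n. s (z n)) \<longlonglongrightarrow> y"
    proof -
      obtain w where w: "\<And>n. w n \<in> range s" "w \<longlonglongrightarrow> y"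
        using y[unfolded closure_sequential] by blast
      then have "\<forall>n. \<exists>z. w n = s z" by blast
      then obtain z where "\<forall>n. w n = s (z n)" by (rule choice[THEN exE])
      then have "w = (\<lambda>n. s (z n))" by auto
      then show thesis using that w(2) by blast
    qed
    obtain x k where k: "strict_mono (k :: nat \<Rightarrow> nat)" "(z \<circ> k) \<longlonglongrightarrow> x"
      using X[unfolded compact_def, rule_format, of z] by auto
    have zk: "(\<lambda>n. s (z (k n))) \<longlonglongrightarrow> y"
      using LIMSEQ_subseq_LIMSEQ[OF z k(1)] by (simp add: o_def)
    show ?thesis
    proof (intro exI[of _ x] allI impI)
      fix e :: real assume "0 < e"
      then obtain d where d: "d > 0" "\<And>x y. \<bar>s x - s y\<bar> < d \<Longrightarrow> dist x y < e / 2"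
        using s[of "e/2"] by auto
      have "\<forall>\<^sub>F n in sequentially. dist (s (z (k n))) y < d / 2 \<and> dist (z (k n)) x < e / 2"
        using tendstoD[OF zk, of "d/2"] tendstoD[OF k(2), of "e/2"] d \<open>0 < e\<close>
        by (auto intro: eventually_conj)
      then obtain n where n: "dist (s (z (k n))) y < d / 2" "dist (z (k n)) x < e / 2"
        using eventually_happens'[OF sequentially_bot] by blast
      show "\<exists>d>0. \<forall>z. \<bar>s z - y\<bar> < d \<longrightarrow> dist z x < e"
      proof (intro exI[of _ "d/2"] conjI allI impI)
        fix w assume "\<bar>s w - y\<bar> < d / 2"
        then have "\<bar>s w - s (z (k n))\<bar> < d" using n unfolding dist_real_def by linarith
        then have "dist w (z (k n)) < e / 2" by (rule d)
        then show "dist w x < e" using n dist_triangle_half_r[of "z (k n)" w e x] by (simp add: dist_commute)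
      qed (use d in simp)
    qed
  qed
  then obtain \<phi> where \<phi>: "\<And>y e. y \<in> closure (range s) \<Longrightarrow> e > 0 \<Longrightarrow>
      \<exists>d>0. \<forall>z. \<bar>s z - y\<bar> < d \<longrightarrow> dist z (\<phi> y) < e" by metis
  show thesis
  proof
    show "\<phi> (s x) = x" for x
    proof -
      have "s x \<in> closure (range s)" by (rule subsetD[OF closure_subset]) simp
      have close: "dist x (\<phi> (s x)) < e" if e: "e > 0" for e
      proof -
        obtain d where "d > 0" and d: "\<And>z. \<bar>s z - s x\<bar> < d \<Longrightarrow> dist z (\<phi> (s x)) < e"
          using \<phi>[OF \<open>s x \<in> closure (range s)\<close> e] by blast
        show ?thesis using d[of x] \<open>d > 0\<close> by simp
      qed
      have "\<not> 0 < dist x (\<phi> (s x))" using close[of "dist x (\<phi> (s x))"] by blast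
      then show ?thesis by simp
    qed
    show "continuous_on (closure (range s)) \<phi>"
      unfolding continuous_on_iff
    proof (intro ballI allI impI)
      fix y and e :: real assume y: "y \<in> closure (range s)" and e: "e > 0"
      obtain d where d: "d > 0" "\<And>z. \<bar>s z - y\<bar> < d \<Longrightarrow> dist z (\<phi> y) < e / 2"
        using \<phi>[OF y, of "e/2"] e by auto
      show "\<exists>d>0. \<forall>x'\<in>closure (range s). dist x' y < d \<longrightarrow> dist (\<phi> x') (\<phi> y) < e"
      proof (intro exI[of _ "d/2"] conjI ballI impI)
        fix y' assume y': "y' \<in> closure (range s)" "dist y' y < d / 2"
        obtain d' where d': "d' > 0" "\<And>z. \<bar>s z - y'\<bar> < d' \<Longrightarrow> dist z (\<phi> y') < e / 2"
          using \<phi>[OF y'(1), of "e/2"] e by auto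
        \<comment> \<open>A code \<open>s z\<close> this close to \<open>y'\<close> is also within
          \<open>d\<close> of \<open>y\<close>, so \<open>z\<close> is near both decoded values and
          links them.\<close>
        have "0 < min d' (d/2)" using d' d by simp
        then obtain z where z: "dist (s z) y' < min d' (d/2)"
          using y'(1) unfolding closure_approachable by blast
        have "\<bar>s z - y'\<bar> < d'" "\<bar>s z - y\<bar> < d"
          using z y'(2) unfolding dist_real_def by linarith+
        then have "dist z (\<phi> y') < e / 2" "dist z (\<phi> y) < e / 2"
          using d(2) d'(2) by blast+
        then show "dist (\<phi> y') (\<phi> y) < e"
          by (metis dist_commute dist_triangle_half_r)
      qed (use d in simp)
    qed
  qed
qed

lemma compact_UNIV_bounded_continuous:
  fixes h :: "'x::topological_space \<Rightarrow> 'b::real_normed_vector"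
  assumes "compact (UNIV :: 'x set)" "continuous_on UNIV h"
  obtains B where "0 < B" "\<And>x. norm (h x) \<le> B"
proof -
  have "bounded (range h)" using assms compact_continuous_image compact_imp_bounded by blast
  then show thesis using that by (auto simp: bounded_pos)
qed

text \<open>
  Push the measures forward along the code, apply Helly's selection theorem on the real line, and pull
  the limit back along the decoder, which is continuous on the closed support of that limit.
\<close>

lemma compact_metric_weak_limit:
  fixes M :: "nat \<Rightarrow> 'x::metric_space measure"
  assumes X: "compact (UNIV :: 'x set)"
    and M: "\<And>k. prob_space (M k)" "\<And>k. sets (M k) = sets borel"
  obtains r :: "nat \<Rightarrow> nat" and \<nu> :: "'x measure"
  where "strict_mono r" "prob_space \<nu>" "sets \<nu> = sets borel"
    and "\<And>h :: 'x \<Rightarrow> complex. continuous_on UNIV h \<Longrightarrow>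
           (\<lambda>k. LINT x|M (r k). h x) \<longlonglongrightarrow> (LINT x|\<nu>. h x)"
proof -
  obtain s :: "'x \<Rightarrow> real" where s[measurable]: "s \<in> borel_measurable borel"
    and s_range: "\<And>x. s x \<in> {0..2}"
    and s_inv: "\<And>e. 0 < e \<Longrightarrow> \<exists>d>0. \<forall>x y. \<bar>s x - s y\<bar> < d \<longrightarrow> dist x y < e"
    using compact_metric_borel_code[OF X] by blast
  obtain \<phi> where \<phi>: "continuous_on (closure (range s)) \<phi>" "\<And>x. \<phi> (s x) = x"
    using code_decoder[OF X s_inv] by blast
  define Y where "Y = closure (range s)"
  have Y: "closed Y" "\<And>x. s x \<in> Y" "Y \<noteq> {}" unfolding Y_def using closure_subset by force+
  note M(2)[measurable_cong]
  define L where "L k = distr (M k) borel s" for k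
  have L: "real_distribution (L k)" for k
    unfolding L_def real_distribution_def real_distribution_axioms_def
    using M by (auto intro!: prob_space.prob_space_distr)
  \<comment> \<open>Tightness is phrased with half-open intervals, so the left end must lie strictly
    below the smallest possible code 0.\<close>
  have L1: "measure (L k) {-1<..2} = 1" for k
  proof -
    have "-1 < s x \<and> s x \<le> 2" for x using s_range[of x] by auto
    then have "s -` {-1<..2} \<inter> space (M k) = space (M k)" by auto
    then show ?thesis unfolding L_def using prob_space.prob_space[OF M(1)] by (simp add: measure_distr)
  qed
  have "tight L" unfolding tight_def
  proof (intro conjI allI impI)
    fix e :: real assume "0 < e"
    then show "\<exists>a b. a < b \<and> (\<forall>n. 1 - e < measure (L n) {a<..b})"
      by (intro exI[of _ "-1"] exI[of _ 2]) (simp add: L1)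
  qed (rule L)
  from tight_imp_convergent_subsubsequence[OF this strict_mono_id]
  obtain r N where r: "strict_mono (r :: nat \<Rightarrow> nat)" and N: "real_distribution N"
    and lim: "weak_conv_m (\<lambda>k. L (r k)) N"
    by (auto simp: o_def)
  interpret N: real_distribution N by (rule N)
  have conv: "(\<lambda>k. LINT x|M (r k). H (s x)) \<longlonglongrightarrow> (LINT y|N. H y)"
    if H: "continuous_on UNIV H" "\<And>y. norm (H y) \<le> B" for H :: "real \<Rightarrow> complex" and B
  proof -
    have [measurable]: "H \<in> borel_measurable borel" using H(1) by (rule borel_measurable_continuous_onI)
    have "(\<lambda>k. integral\<^sup>L (L (r k)) H) \<longlonglongrightarrow> integral\<^sup>L N H"
      using H by (intro weak_conv_imp_integral_bdd_continuous_conv[OF L N lim])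
        (auto simp: continuous_on_eq_continuous_at)
    then show ?thesis unfolding L_def by (simp add: integral_distr)
  qed
  \<comment> \<open>The truncated distance to \<open>Y\<close> is bounded and continuous and
    vanishes at every code. Its integral against the limit \<open>N\<close> is therefore 0, and
    closedness of \<open>Y\<close> turns distance 0 into membership.\<close>
  have AE_Y: "AE y in N. y \<in> Y"
  proof -
    define u where "u y = min 1 (infdist y Y)" for y :: real
    have u: "continuous_on UNIV u" unfolding u_def by (intro continuous_intros)
    have ub: "0 \<le> u y" "u y \<le> 1" for y unfolding u_def by (auto simp: infdist_nonneg)
    have [measurable]: "u \<in> borel_measurable borel" using u by (rule borel_measurable_continuous_onI)
    have "(\<lambda>k. LINT x|M (r k). complex_of_real (u (s x))) \<longlonglongrightarrow> (LINT y|N. complex_of_real (u y))"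
      using ub by (intro conv[of _ 1] continuous_intros u) auto
    moreover have "u (s x) = 0" for x using Y(2)[of x] by (simp add: u_def)
    ultimately have "(LINT y|N. complex_of_real (u y)) = 0"
      by (simp add: LIMSEQ_const_iff)
    then have "(LINT y|N. u y) = 0" by simp
    moreover have "integrable N u" using ub by (intro N.integrable_const_bound[of _ 1]) auto
    ultimately have "AE y in N. u y = 0"
      using ub by (subst (asm) integral_nonneg_eq_0_iff_AE) auto
    then show ?thesis
      by eventually_elim (use Y in_closed_iff_infdist_zero[of Y] in \<open>auto simp: u_def min_def split: if_splits\<close>)
  qed
  \<comment> \<open>The decoder is controlled only on \<open>Y\<close>. A constant value elsewhere
    makes it Borel on the whole line, and the complement of \<open>Y\<close> is null for
    \<open>N\<close>.\<close>
  define \<psi> where "\<psi> y = (if y \<in> Y then \<phi> y else undefined)" for y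
  have [measurable]: "\<psi> \<in> borel_measurable borel"
    unfolding \<psi>_def using \<phi>(1) Y(1)
    by (intro borel_measurable_continuous_on_if) (auto simp: Y_def)
  define \<nu> where "\<nu> = distr N borel \<psi>"
  show thesis
  proof (rule that[OF r])
    show "prob_space \<nu>" unfolding \<nu>_def by (intro N.prob_space_distr) simp
    show "sets \<nu> = sets borel" by (simp add: \<nu>_def)
    fix h :: "'x \<Rightarrow> complex" assume h: "continuous_on UNIV h"
    have hm[measurable]: "h \<in> borel_measurable borel" using h by (rule borel_measurable_continuous_onI)
    obtain B where B: "0 < B" "\<And>x. norm (h x) \<le> B"
      using compact_UNIV_bounded_continuous[OF X h] by blast
    \<comment> \<open>Weak convergence tests only bounded continuous functions on all of the line,
      so the decoded \<open>h\<close> is extended from \<open>Y\<close> by Tietze with the same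
      bound. On codes the extension still returns \<open>h\<close>.\<close>
    have "continuous_on Y (\<lambda>y. h (\<phi> y))"
      using \<phi>(1) unfolding Y_def by (intro continuous_on_compose2[OF h]) auto
    then obtain H where H: "continuous_on UNIV H" "\<And>y. y \<in> Y \<Longrightarrow> H y = h (\<phi> y)"
        "\<And>y. norm (H y) \<le> B"
      using Tietze[of Y "\<lambda>y. h (\<phi> y)" UNIV B] B Y(1) by (auto simp: closed_closedin[symmetric])
    have [measurable]: "H \<in> borel_measurable borel" using H(1) by (rule borel_measurable_continuous_onI)
    have "(LINT x|\<nu>. h x) = (LINT y|N. h (\<psi> y))" unfolding \<nu>_def by (simp add: integral_distr)
    also have "\<dots> = (LINT y|N. H y)"
    proof (rule integral_cong_AE)
      show "AE y in N. h (\<psi> y) = H y"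
        using AE_Y by eventually_elim (simp add: H(2) \<psi>_def)
    qed simp_all
    finally show "(\<lambda>k. LINT x|M (r k). h x) \<longlonglongrightarrow> (LINT x|\<nu>. h x)"
      using conv[OF H(1,3)] H(2) Y(2) \<phi>(2) by simp
  qed
qed

section \<open>Measures determined by continuous functions\<close>

text \<open>Indicators of open sets are pointwise limits of truncated multiples of the distance to
  the complement, so both measures agree on open sets. These are stable under intersection and
  generate the Borel sets.\<close>

lemma measure_eqI_continuous:
  fixes M N :: "'x::metric_space measure"
  assumes M: "finite_measure M" "sets M = sets borel"
    and N: "finite_measure N" "sets N = sets borel"
    and eq: "\<And>h :: 'x \<Rightarrow> real. continuous_on UNIV h \<Longrightarrow> (\<And>x. \<bar>h x\<bar> \<le> 1) \<Longrightarrow>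
               (LINT x|M. h x) = (LINT x|N. h x)"
  shows "M = N"
proof -
  have mopen: "(\<lambda>n. LINT x|K. min 1 (real n * infdist x (- U))) \<longlonglongrightarrow> measure K U"
    if K: "finite_measure K" "sets K = sets borel" and U: "open U" "U \<noteq> UNIV" for K :: "'x measure" and U
  proof -
    interpret finite_measure K by fact
    note K(2)[measurable_cong]
    have [measurable]: "U \<in> sets borel" using U by simp
    have cont: "continuous_on UNIV (\<lambda>x. min 1 (real n * infdist x (- U)))" for n
      by (intro continuous_intros)
    have [measurable]: "(\<lambda>x. min 1 (real n * infdist x (- U))) \<in> borel_measurable borel" for n
      by (rule borel_measurable_continuous_onI[OF cont])
    have "(\<lambda>n. LINT x|K. min 1 (real n * infdist x (- U))) \<longlonglongrightarrow> (LINT x|K. indicat_real U x)"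
    proof (rule integral_dominated_convergence[where w="\<lambda>_. 1"])
      show "AE x in K. (\<lambda>n. min 1 (real n * infdist x (- U))) \<longlonglongrightarrow> indicator U x"
      proof (rule AE_I2)
        fix x
        show "(\<lambda>n. min 1 (real n * infdist x (- U))) \<longlonglongrightarrow> indicator U x"
        proof (cases "x \<in> U")
          case True
          then have pos: "0 < infdist x (- U)"
            using U in_closed_iff_infdist_zero[of "- U" x] infdist_nonneg[of x "- U"]
            by (force simp: less_le)
          obtain n0 :: nat where n0: "1 / infdist x (- U) < n0" using reals_Archimedean2 by blast
          have "min 1 (real n * infdist x (- U)) = 1" if "n \<ge> n0" for n
          proof -
            have "1 / infdist x (- U) < real n" using n0 that by linarith
            then show ?thesis using pos by (simp add: field_simps)
          qed
          then have "\<forall>\<^sub>F n in sequentially. min 1 (real n * infdist x (- U)) = indicator U x"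
            using True by (auto simp: eventually_sequentially)
          then show ?thesis by (rule tendsto_eventually)
        qed simp
      qed
    qed (auto simp: infdist_nonneg)
    then show ?thesis using K(2) by (simp add: Int_absorb2 sets_eq_imp_space_eq)
  qed
  have meq: "measure M U = measure N U" if "open U" for U
  \<comment> \<open>The distance to the empty set is 0 by convention, so the approximating functions
    would all vanish for the whole space. Total masses are compared by the constant 1
    instead.\<close>
  proof (cases "U = UNIV")
    case True
    have "(LINT x|M. 1) = (LINT x|N. (1::real))" by (rule eq) auto
    then show ?thesis using True sets_eq_imp_space_eq[OF M(2)] sets_eq_imp_space_eq[OF N(2)] by simp
  next
    case False
    have "(LINT x|M. min 1 (real n * infdist x (- U))) = (LINT x|N. min 1 (real n * infdist x (- U)))" for n
      by (intro eq continuous_intros) (auto simp: infdist_nonneg abs_le_iff min_def)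
    then show ?thesis using mopen[OF M that False] mopen[OF N that False] LIMSEQ_unique by simp
  qed
  show ?thesis
  proof (rule measure_eqI_generator_eq[where E="{U. open U}" and \<Omega>=UNIV and A="\<lambda>_. UNIV"])
    show "emeasure M U = emeasure N U" if "U \<in> {U. open U}" for U
      using that meq M N by (simp add: finite_measure.emeasure_eq_measure)
    show "emeasure M UNIV \<noteq> \<infinity>"
      using M by (simp add: finite_measure.emeasure_eq_measure)
  qed (use M N in \<open>auto simp: Int_stable_def borel_def\<close>)
qed

section \<open>Normalised restrictions of a measure\<close>

lemma integral_uniform_measure:
  fixes f :: "'a \<Rightarrow> 'b::{banach, second_countable_topology}"
  assumes A: "0 < measure M A" and f[measurable]: "f \<in> borel_measurable M"
  shows "(LINT x|uniform_measure M A. f x) = (1 / measure M A) *\<^sub>R (LINT x:A|M. f x)"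
proof -
  \<comment> \<open>\<open>measure\<close> takes the value 0 on non-measurable sets and on sets of
    infinite measure, so positivity yields both measurability and finiteness.\<close>
  have [measurable]: "A \<in> sets M" using A measure_notin_sets by fastforce
  have fin: "emeasure M A = ennreal (measure M A)"
    using A emeasure_eq_ennreal_measure[of M A] by (cases "emeasure M A = top") (auto simp: measure_def)
  have "(\<lambda>x. indicator A x / emeasure M A) = (\<lambda>x. ennreal (indicator A x / measure M A))"
    unfolding fin using A by (auto simp: fun_eq_iff divide_ennreal ennreal_1[symmetric] indicator_def simp del: ennreal_1)
  then have "uniform_measure M A = density M (\<lambda>x. ennreal (indicator A x / measure M A))"
    unfolding uniform_measure_def by simp
  then have "(LINT x|uniform_measure M A. f x) = (LINT x|M. (indicator A x / measure M A) *\<^sub>R f x)"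
    by (simp add: integral_density)
  also have "\<dots> = (LINT x|M. (1 / measure M A) *\<^sub>R indicator A x *\<^sub>R f x)" by simp
  also have "\<dots> = (1 / measure M A) *\<^sub>R (LINT x:A|M. f x)"
    unfolding set_lebesgue_integral_def by (rule integral_scaleR_right)
  finally show ?thesis .
qed

lemma prob_space_uniform_measure':
  assumes "0 < measure M A"
  shows "prob_space (uniform_measure M A)"
  using assms by (intro prob_space_uniform_measure) (metis less_irrefl measure_def enn2real_0 enn2real_top infinity_ennreal_def)+

section \<open>Joint measurability of a continuous action\<close>

lemma continuous_on_pair_sections:
  assumes T: "continuous_on UNIV (\<lambda>(g, x). T g x)"
  shows "continuous_on UNIV (T g)" "continuous_on UNIV (\<lambda>g. T g x)"
proof -
  have "continuous_on UNIV (\<lambda>x. (\<lambda>(g, x). T g x) (g, x))"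
    by (rule continuous_on_compose2[OF T]) (auto intro!: continuous_intros)
  then show "continuous_on UNIV (T g)" by simp
  have "continuous_on UNIV (\<lambda>g. (\<lambda>(g, x). T g x) (g, x))"
    by (rule continuous_on_compose2[OF T]) (auto intro!: continuous_intros)
  then show "continuous_on UNIV (\<lambda>g. T g x)" by simp
qed

text \<open>A form of the tube lemma: the complement is the projection of a closed set along a
  compact factor, and such a projection is a closed map.\<close>

lemma open_forall_compact:
  fixes T :: "'g::topological_space \<Rightarrow> 'x::topological_space \<Rightarrow> 'y::topological_space"
  assumes T: "continuous_on UNIV (\<lambda>(g, x). T g x)"
    and X: "compact (UNIV :: 'x set)" and K: "closed K" and V: "open V"
  shows "open {g. \<forall>x\<in>K. T g x \<in> V}"
proof -
  define C where "C = (\<lambda>(g, x). T g x) -` (- V) \<inter> (UNIV \<times> K)"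
  have "closed C" unfolding C_def
    using T K V by (intro closed_Int closed_Times closed_vimage) auto
  moreover have "closed_map (prod_topology (euclidean :: 'g topology) (euclidean :: 'x topology)) euclidean fst"
    using X by (intro Abstract_Topological_Spaces.closed_map_fst) (simp add: compact_space_def)
  ultimately have "closed (fst ` C)" unfolding closed_map_def by simp
  moreover have "fst ` C = {g. \<exists>x\<in>K. T g x \<notin> V}" unfolding C_def by force
  then have "{g. \<forall>x\<in>K. T g x \<in> V} = - (fst ` C)" by auto
  ultimately show ?thesis by (simp add: open_Compl)
qed

text \<open>
  The group need not be second countable, so the Borel sets of the product may be strictly larger than
  the product of the Borel sets; compactness of the second factor rescues measurability.
\<close>

lemma jointly_continuous_imp_pair_measurable:
  fixes T :: "'g::topological_space \<Rightarrow> 'x::metric_space \<Rightarrow> 'y::topological_space"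
  assumes T: "continuous_on UNIV (\<lambda>(g, x). T g x)" and X: "compact (UNIV :: 'x set)"
  shows "(\<lambda>(g, x). T g x) \<in> borel \<Otimes>\<^sub>M borel \<rightarrow>\<^sub>M borel"
proof (rule borel_measurableI)
  fix V :: "'y set" assume V: "open V"
  obtain c :: "nat \<Rightarrow> 'x" and r where
    basis: "\<And>W x. open W \<Longrightarrow> x \<in> W \<Longrightarrow> \<exists>n. x \<in> ball (c n) (r n) \<and> cball (c n) (r n) \<subseteq> W"
    using compact_UNIV_imp_countable_ball_basis[OF X] by metis
  \<comment> \<open>Each \<open>O' n\<close> is open, and the preimage of \<open>V\<close> will be
    the countable union of the rectangles \<open>O' n \<times> ball (c n) (r n)\<close>, which do
    belong to the product of the Borel sigma-algebras.\<close>
  define O' where "O' n = {g. \<forall>x\<in>cball (c n) (r n). T g x \<in> V}" for n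
  have O': "open (O' n)" for n
    unfolding O'_def by (rule open_forall_compact[OF T X _ V]) simp
  have "(\<lambda>(g, x). T g x) -` V = (\<Union>n. O' n \<times> ball (c n) (r n))"
  proof (intro subset_antisym subsetI)
    fix p assume p: "p \<in> (\<lambda>(g, x). T g x) -` V"
    obtain g x where gx: "p = (g, x)" by fastforce
    have "continuous_on UNIV (\<lambda>x. T g x)"
      by (rule continuous_on_pair_sections[OF T])
    then have "open ((\<lambda>x. T g x) -` V)" using V by (rule open_vimage[rotated])
    then obtain n where "x \<in> ball (c n) (r n)" "cball (c n) (r n) \<subseteq> (\<lambda>x. T g x) -` V"
      using basis[of "(\<lambda>x. T g x) -` V" x] p gx by auto
    then have "g \<in> O' n" unfolding O'_def by auto
    then show "p \<in> (\<Union>n. O' n \<times> ball (c n) (r n))" using \<open>x \<in> ball (c n) (r n)\<close> gx by blast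
  next
    fix p assume "p \<in> (\<Union>n. O' n \<times> ball (c n) (r n))"
    then obtain n g x where "p = (g, x)" "g \<in> O' n" "x \<in> ball (c n) (r n)" by auto
    then show "p \<in> (\<lambda>(g, x). T g x) -` V"
      unfolding O'_def by (auto simp: ball_subset_cball[THEN subsetD])
  qed
  moreover have "(\<Union>n. O' n \<times> ball (c n) (r n)) \<in> sets (borel \<Otimes>\<^sub>M borel)"
    using O' by (intro sets.countable_UN) auto
  ultimately show "(\<lambda>(g, x). T g x) -` V \<inter> space (borel \<Otimes>\<^sub>M borel) \<in> sets (borel \<Otimes>\<^sub>M borel)"
    by (simp add: space_pair_measure)
qed

lemma (in prob_space) norm_integral_le_bound:
  fixes f :: "'a \<Rightarrow> 'b::{banach, second_countable_topology}"
  assumes "\<And>x. norm (f x) \<le> B"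
  shows "norm (\<integral>x. f x \<partial>M) \<le> B"
proof -
  have B: "0 \<le> B" using assms norm_ge_zero order_trans by blast
  show ?thesis
  proof (cases "integrable M f")
    case True
    have "norm (\<integral>x. f x \<partial>M) \<le> (\<integral>x. norm (f x) \<partial>M)" by (rule integral_norm_bound)
    also have "\<dots> \<le> (\<integral>x. B \<partial>M)" using True assms by (intro integral_mono) auto
    finally show ?thesis by (simp add: prob_space)
  \<comment> \<open>The integral of a non-integrable function is 0 by convention, so
    \<open>0 \<le> B\<close> settles this case.\<close>
  qed (simp add: not_integrable_integral_eq B)
qed

section \<open>Averages along a continuous action\<close>

locale haar_compact_action =
  fixes m :: "'g::{topological_group_add, t2_space} measure"
    and T :: "'g \<Rightarrow> 'x::metric_space \<Rightarrow> 'x"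
  assumes haar: "left_haar_measure m"
    and compact_X: "compact (UNIV :: 'x set)"
    and action: "continuous_action T"
begin

lemma sets_m [measurable_cong, simp]: "sets m = sets borel"
  using haar by (simp add: left_haar_measure_def)

lemma space_m [simp]: "space m = UNIV"
  using sets_eq_imp_space_eq[OF sets_m] by simp

lemma compact_sets_m: "compact K \<Longrightarrow> K \<in> sets m"
  by (simp add: compact_imp_closed)

lemma compact_emeasure_less_top: "compact K \<Longrightarrow> emeasure m K < \<infinity>"
  using haar by (simp add: left_haar_measure_def)

lemma emeasure_translation:
  "A \<in> sets borel \<Longrightarrow> emeasure m ((\<lambda>x. g + x) ` A) = emeasure m A"
  using haar by (simp add: left_haar_measure_def)

lemma T_add: "T (g + h) x = T g (T h x)"
  using action by (simp add: continuous_action_def)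

lemma T_continuous: "continuous_on UNIV (\<lambda>(g, x). T g x)"
  using action by (simp add: continuous_action_def)

lemma T_continuous_point: "continuous_on UNIV (T g)"
  by (rule continuous_on_pair_sections[OF T_continuous])

lemma T_continuous_group: "continuous_on UNIV (\<lambda>g. T g x)"
  by (rule continuous_on_pair_sections[OF T_continuous])

lemma T_measurable_pair: "(\<lambda>(g, x). T g x) \<in> borel \<Otimes>\<^sub>M borel \<rightarrow>\<^sub>M borel"
  by (rule jointly_continuous_imp_pair_measurable[OF T_continuous compact_X])

lemma T_measurable_point [measurable]: "T g \<in> borel \<rightarrow>\<^sub>M borel"
  by (rule borel_measurable_continuous_onI[OF T_continuous_point])

lemma T_measurable_group [measurable]: "(\<lambda>g. T g x) \<in> borel \<rightarrow>\<^sub>M borel"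
  by (rule borel_measurable_continuous_onI[OF T_continuous_group])

lemma translation_continuous: "continuous_on UNIV (\<lambda>x :: 'g. g + x)"
  by (intro continuous_intros)

lemma translation_measurable [measurable]: "(\<lambda>x :: 'g. g + x) \<in> borel \<rightarrow>\<^sub>M borel"
  by (rule borel_measurable_continuous_onI[OF translation_continuous])

lemma translation_image: "(\<lambda>x :: 'g. g + x) ` A = (\<lambda>x. - g + x) -` A"
proof -
  have "x \<in> (+) g ` A" if "- g + x \<in> A" for x
    using that by (intro image_eqI[of _ _ "- g + x"]) auto
  then show ?thesis by auto
qed

lemma distr_translation: "distr m borel (\<lambda>x. g + x) = m"
proof (rule measure_eqI)
  fix A assume "A \<in> sets (distr m borel (\<lambda>x. g + x))"
  then have A: "A \<in> sets borel" by simp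
  have "emeasure (distr m borel (\<lambda>x. g + x)) A = emeasure m ((\<lambda>x. g + x) -` A)"
    using A by (simp add: emeasure_distr)
  also have "(\<lambda>x. g + x) -` A = (\<lambda>x. - g + x) ` A"
    using translation_image[of "- g" A] by simp
  finally show "emeasure (distr m borel (\<lambda>x. g + x)) A = emeasure m A"
    using emeasure_translation[OF A] by simp
qed simp

text \<open>Left invariance of \<open>m\<close> trades a translated integrand for a translated
  domain of integration, which is where the Folner condition can act.\<close>

lemma integral_translation:
  fixes \<phi> :: "'g \<Rightarrow> complex"
  assumes [measurable]: "\<phi> \<in> borel_measurable borel" "A \<in> sets borel"
  shows "(LINT a:A|m. \<phi> (g + a)) = (LINT a:(\<lambda>x. g + x) ` A|m. \<phi> a)"
proof -
  have [measurable]: "(\<lambda>x. g + x) ` A \<in> sets borel"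
    unfolding translation_image by (rule measurable_sets_borel[OF translation_measurable]) simp
  have "(LINT a:(\<lambda>x. g + x) ` A|m. \<phi> a) = (LINT a:(\<lambda>x. g + x) ` A|distr m borel (\<lambda>x. g + x). \<phi> a)"
    by (simp only: distr_translation)
  also have "\<dots> = (LINT a|m. indicator ((\<lambda>x. g + x) ` A) (g + a) *\<^sub>R \<phi> (g + a))"
    unfolding set_lebesgue_integral_def by (subst integral_distr) auto
  also have "\<dots> = (LINT a:A|m. \<phi> (g + a))"
    unfolding set_lebesgue_integral_def by (intro Bochner_Integration.integral_cong) (auto simp: indicator_def)
  finally show ?thesis ..
qed

section \<open>Continuity, Fubini and translation estimates for averages\<close>

context
  fixes h :: "'x \<Rightarrow> complex"
  assumes h: "continuous_on UNIV h"
begin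

lemma h_measurable [measurable]: "h \<in> borel_measurable borel"
  using h by (rule borel_measurable_continuous_onI)

text \<open>Haar measure need not be sigma-finite, but its normalised restriction is a probability
  measure. In this form constants are integrable dominating functions and Fubini applies.\<close>

lemma Avg_eq_integral:
  assumes "0 < measure m K"
  shows "Avg m T K h x = (LINT g|uniform_measure m K. h (T g x))"
  using assms unfolding Avg_def
  by (subst integral_uniform_measure) (auto simp: scaleR_conv_of_real divide_inverse mult.commute)

lemma Avg_norm_le:
  assumes "0 < measure m K" "\<And>x. norm (h x) \<le> B"
  shows "norm (Avg m T K h x) \<le> B"
  unfolding Avg_eq_integral[OF assms(1)]
  using assms by (intro prob_space.norm_integral_le_bound prob_space_uniform_measure')

text \<open>On a metric space sequential continuity suffices, and it follows from dominated
  convergence with a bound of \<open>h\<close> as the dominating constant.\<close>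

lemma Avg_continuous:
  assumes "0 < measure m K"
  shows "continuous_on UNIV (Avg m T K h)"
proof -
  interpret P: prob_space "uniform_measure m K" using assms by (rule prob_space_uniform_measure')
  obtain B where B: "\<And>x. norm (h x) \<le> B"
    using compact_UNIV_bounded_continuous[OF compact_X h] by blast
  show ?thesis
  proof (rule continuous_on_sequentiallyI)
    fix u :: "nat \<Rightarrow> 'x" and a assume u: "u \<longlonglongrightarrow> a"
    show "(\<lambda>n. Avg m T K h (u n)) \<longlonglongrightarrow> Avg m T K h a"
      unfolding Avg_eq_integral[OF assms]
    proof (rule integral_dominated_convergence[where w="\<lambda>_. B"])
      show "AE g in uniform_measure m K. (\<lambda>n. h (T g (u n))) \<longlonglongrightarrow> h (T g a)"
      proof (rule AE_I2)
        fix g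
        have "continuous_on UNIV (\<lambda>x. h (T g x))"
          by (intro continuous_on_compose2[OF h T_continuous_point]) auto
        then show "(\<lambda>n. h (T g (u n))) \<longlonglongrightarrow> h (T g a)"
          using u by (auto intro: continuous_on_tendsto_compose)
      qed
    qed (use B in auto)
  qed
qed

text \<open>The first form shows that integrating averages is integrating \<open>h\<close> against
  an image of a product measure. The second exchanges the order, so that the inner integral runs
  over the space.\<close>

lemma integral_Avg_pair:
  assumes K: "0 < measure m K" and Q: "prob_space Q" "sets Q = sets borel"
  shows "(LINT x|Q. Avg m T K h x) = (LINT p|(uniform_measure m K \<Otimes>\<^sub>M Q). h (T (fst p) (snd p)))"
    and "(LINT x|Q. Avg m T K h x) = (LINT g|uniform_measure m K. LINT x|Q. h (T g x))"
proof -
  interpret K: prob_space "uniform_measure m K" using K by (rule prob_space_uniform_measure')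
  interpret Q: prob_space Q by fact
  interpret pair_prob_space "uniform_measure m K" Q ..
  note Q(2)[measurable_cong]
  have sets: "sets (uniform_measure m K \<Otimes>\<^sub>M Q) = sets (borel \<Otimes>\<^sub>M borel)"
    using Q(2) by (intro sets_pair_measure_cong) simp_all
  obtain B where B: "\<And>x. norm (h x) \<le> B"
    using compact_UNIV_bounded_continuous[OF compact_X h] by blast
  have [measurable]: "(\<lambda>p. T (fst p) (snd p)) \<in> borel \<Otimes>\<^sub>M borel \<rightarrow>\<^sub>M borel"
    using T_measurable_pair by (simp add: case_prod_beta')
  have "(\<lambda>p. h (T (fst p) (snd p))) \<in> borel_measurable (borel \<Otimes>\<^sub>M borel)" by measurable
  then have meas: "(\<lambda>p. h (T (fst p) (snd p))) \<in> borel_measurable (uniform_measure m K \<Otimes>\<^sub>M Q)"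
    by (simp only: measurable_cong_sets[OF sets refl])
  have int: "integrable (uniform_measure m K \<Otimes>\<^sub>M Q) (\<lambda>(g, x). h (T g x))"
    using meas B by (intro P.integrable_const_bound[of _ B]) (auto simp: case_prod_beta')
  show "(LINT x|Q. Avg m T K h x) = (LINT p|(uniform_measure m K \<Otimes>\<^sub>M Q). h (T (fst p) (snd p)))"
    unfolding Avg_eq_integral[OF K] using integral_snd[OF int] by (simp add: case_prod_beta')
  show "(LINT x|Q. Avg m T K h x) = (LINT g|uniform_measure m K. LINT x|Q. h (T g x))"
    unfolding Avg_eq_integral[OF K] by (rule Fubini_integral[OF int])
qed

text \<open>After the exchange of integrals, invariance removes \<open>g\<close> from the inner
  integral, and the outer one averages a constant.\<close>

lemma integral_Avg_invariant:
  assumes K: "0 < measure m K" and \<nu>: "\<nu> \<in> invariant_measures T"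
  shows "(LINT x|\<nu>. Avg m T K h x) = (LINT x|\<nu>. h x)"
proof -
  interpret P: prob_space "uniform_measure m K" using K by (rule prob_space_uniform_measure')
  have \<nu>': "prob_space \<nu>" "sets \<nu> = sets borel"
    "\<And>g A. A \<in> sets borel \<Longrightarrow> emeasure \<nu> (T g -` A) = emeasure \<nu> A"
    using \<nu> unfolding invariant_measures_def by auto
  note \<nu>'(2)[measurable_cong]
  have "distr \<nu> borel (T g) = \<nu>" for g
    using \<nu>'(2,3) sets_eq_imp_space_eq[OF \<nu>'(2)]
    by (intro measure_eqI) (auto simp: emeasure_distr)
  then have "(LINT x|\<nu>. h (T g x)) = (LINT x|\<nu>. h x)" for g
    using integral_distr[of "T g" \<nu> borel h] by simp
  then show ?thesis
    unfolding integral_Avg_pair(2)[OF K \<nu>'(1,2)] using P.prob_space by simp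
qed

text \<open>Replacing \<open>h\<close> by its translate shifts the domain from \<open>K\<close> to
  its translate by \<open>g\<close>. The two integrals differ only over the symmetric difference,
  where the integrand is bounded by \<open>B\<close>.\<close>

lemma Avg_translate_diff:
  assumes K: "compact K" "0 < measure m K" and B: "\<And>x. norm (h x) \<le> B"
  shows "norm (Avg m T K (\<lambda>x. h (T g x)) x - Avg m T K h x)
           \<le> B * (measure m (sym_diff ((\<lambda>a. g + a) ` K) K) / measure m K)"
proof -
  let ?gK = "(\<lambda>a. g + a) ` K"
  have gK: "compact ?gK" using K(1) translation_continuous[of g]
    by (intro compact_continuous_image) (auto intro: continuous_on_subset)
  note [measurable] = compact_sets_m[OF K(1), simplified] compact_sets_m[OF gK, simplified]
  have int: "integrable m (\<lambda>a. indicator A a *\<^sub>R h (T a x))" if A: "compact A" for A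
  proof (rule integrableI_bounded_set_indicator[where B=B])
    show "A \<in> sets m" using A by (rule compact_sets_m)
    show "emeasure m A < \<infinity>" using A by (rule compact_emeasure_less_top)
  qed (use B in auto)
  have fin: "integrable m (indicat_real (sym_diff ?gK K))"
  proof (rule integrable_real_indicator)
    have "emeasure m (sym_diff ?gK K) \<le> emeasure m (?gK \<union> K)" by (intro emeasure_mono) auto
    also have "\<dots> < \<infinity>" using K(1) gK by (intro compact_emeasure_less_top compact_Un)
    finally show "emeasure m (sym_diff ?gK K) < \<infinity>" .
  qed simp
  have "norm ((LINT a:?gK|m. h (T a x)) - (LINT a:K|m. h (T a x)))
      = norm (LINT a|m. (indicat_real ?gK a - indicator K a) *\<^sub>R h (T a x))"
    unfolding set_lebesgue_integral_def
    by (subst Bochner_Integration.integral_diff[symmetric]) (auto intro: int gK K simp: algebra_simps)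
  also have "\<dots> \<le> (LINT a|m. norm ((indicat_real ?gK a - indicator K a) *\<^sub>R h (T a x)))"
    by (rule integral_norm_bound)
  also have "\<dots> \<le> (LINT a|m. B * indicator (sym_diff ?gK K) a)"
  proof (rule integral_mono)
    show "integrable m (\<lambda>a. norm ((indicat_real ?gK a - indicator K a) *\<^sub>R h (T a x)))"
      using Bochner_Integration.integrable_diff[OF int[OF gK] int[OF K(1)]]
      by (intro integrable_norm) (simp add: algebra_simps)
    have "0 \<le> B" using B norm_ge_zero order_trans by blast
    then show "norm ((indicat_real ?gK a - indicator K a) *\<^sub>R h (T a x)) \<le> B * indicator (sym_diff ?gK K) a" for a
      using B by (auto simp: indicator_def)
  qed (use fin in auto)
  also have "\<dots> = B * measure m (sym_diff ?gK K)" by simp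
  finally have le: "norm ((LINT a:?gK|m. h (T a x)) - (LINT a:K|m. h (T a x))) \<le> B * measure m (sym_diff ?gK K)" .
  have "(LINT a:K|m. h (T g (T a x))) = (LINT a:?gK|m. h (T a x))"
    using integral_translation[of "\<lambda>a. h (T a x)" K g] by (simp add: T_add)
  then have "Avg m T K (\<lambda>x. h (T g x)) x - Avg m T K h x
      = ((LINT a:?gK|m. h (T a x)) - (LINT a:K|m. h (T a x))) / complex_of_real (measure m K)"
    by (simp add: Avg_def diff_divide_distrib)
  then show ?thesis using le K(2) by (simp add: norm_divide divide_right_mono)
qed

end

text \<open>One subsequence and one invariant measure serve all test functions \<open>h\<close> at
  once. This is what allows invariance of the limit to be read off by comparing \<open>h\<close>
  with its translates.\<close>

lemma alpha_Avg_limit_point: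
  assumes F: "folner_sequence m F" and \<mu>: "prob_space \<mu>" "sets \<mu> = sets borel"
    and C: "\<And>k. 0 < measure \<mu> (C k)"
  obtains r :: "nat \<Rightarrow> nat" and \<nu> where "strict_mono r" "\<nu> \<in> invariant_measures T"
    and "\<And>h. continuous_on UNIV h \<Longrightarrow>
          (\<lambda>k. LINT x|uniform_measure \<mu> (C (r k)). Avg m T (F (r k)) h x) \<longlonglongrightarrow> (LINT x|\<nu>. h x)"
proof -
  have F': "\<And>k. compact (F k)" "\<And>k. 0 < measure m (F k)"
    "\<And>g. (\<lambda>k. measure m (sym_diff ((\<lambda>x. g + x) ` F k) (F k)) / measure m (F k)) \<longlonglongrightarrow> 0"
    using F unfolding folner_sequence_def by auto
  define P where "P k = uniform_measure m (F k)" for k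
  define Q where "Q k = uniform_measure \<mu> (C k)" for k
  have P: "prob_space (P k)" and Q: "prob_space (Q k)" "sets (Q k) = sets borel" for k
    unfolding P_def Q_def using F'(2) C \<mu>(2) by (auto intro: prob_space_uniform_measure')
  have sets: "sets (P k \<Otimes>\<^sub>M Q k) = sets (borel \<Otimes>\<^sub>M borel)" for k
    using Q(2) by (intro sets_pair_measure_cong) (simp_all add: P_def)
  have T': "(\<lambda>p. T (fst p) (snd p)) \<in> P k \<Otimes>\<^sub>M Q k \<rightarrow>\<^sub>M borel" for k
    using T_measurable_pair by (simp add: case_prod_beta' measurable_cong_sets[OF sets refl])
  define M where "M k = distr (P k \<Otimes>\<^sub>M Q k) borel (\<lambda>p. T (fst p) (snd p))" for k
  have M: "prob_space (M k)" "sets (M k) = sets borel" for k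
  proof -
    interpret PP: prob_space "P k" by (rule P)
    interpret Q: prob_space "Q k" by (rule Q)
    interpret PQ: pair_prob_space "P k" "Q k" ..
    show "prob_space (M k)" unfolding M_def using T' by (rule PQ.P.prob_space_distr)
  qed (simp add: M_def)
  have int_M: "(LINT x|M k. h x) = (LINT x|Q k. Avg m T (F k) h x)" if h: "continuous_on UNIV h" for h k
    using integral_distr[OF T' h_measurable[OF h], of k] integral_Avg_pair(1)[OF h F'(2) Q, of k]
    by (simp add: M_def P_def)
  obtain r \<nu> where r: "strict_mono (r :: nat \<Rightarrow> nat)" and \<nu>: "prob_space \<nu>" "sets \<nu> = sets borel"
    and lim: "\<And>h. continuous_on UNIV h \<Longrightarrow> (\<lambda>k. LINT x|M (r k). h x) \<longlonglongrightarrow> (LINT x|\<nu>. h x :: complex)"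
    by (rule compact_metric_weak_limit[OF compact_X M]) (rule that)
  note \<nu>(2)[measurable_cong]
  \<comment> \<open>Integrating the pointwise translation estimate over the probability measure
    \<open>Q k\<close> bounds the defect of invariance of \<open>M k\<close> by \<open>B\<close>
    times the Folner ratio, which tends to 0.\<close>
  have inv: "(LINT x|\<nu>. h (T g x)) = (LINT x|\<nu>. h x)" if h: "continuous_on UNIV h" for h :: "'x \<Rightarrow> complex" and g
  proof -
    have hT: "continuous_on UNIV (\<lambda>x. h (T g x))"
      by (intro continuous_on_compose2[OF h T_continuous_point]) auto
    obtain B where B: "0 < B" "\<And>x. norm (h x) \<le> B"
      using compact_UNIV_bounded_continuous[OF compact_X h] by blast
    let ?q = "\<lambda>k. measure m (sym_diff ((\<lambda>x. g + x) ` F k) (F k)) / measure m (F k)"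
    have bound: "norm ((LINT x|M k. h (T g x)) - (LINT x|M k. h x)) \<le> B * ?q k" for k
    proof -
      interpret Q: prob_space "Q k" by (rule Q)
      have int: "integrable (Q k) (Avg m T (F k) u)" if u: "continuous_on UNIV u" for u :: "'x \<Rightarrow> complex"
      proof -
        obtain b where b: "\<And>x. norm (u x) \<le> b"
          using compact_UNIV_bounded_continuous[OF compact_X u] by blast
        have "Avg m T (F k) u \<in> borel_measurable (Q k)"
          using borel_measurable_continuous_onI[OF Avg_continuous[OF u F'(2)]]
          by (simp add: measurable_cong_sets[OF Q(2) refl])
        then show ?thesis
          using Avg_norm_le[OF u F'(2) b] by (intro Q.integrable_const_bound[of _ b]) auto
      qed
      have "(LINT x|M k. h (T g x)) - (LINT x|M k. h x)
          = (LINT x|Q k. Avg m T (F k) (\<lambda>x. h (T g x)) x - Avg m T (F k) h x)"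
        by (simp add: int_M h hT int)
      then show ?thesis
        using Avg_translate_diff[OF h F'(1,2) B(2)] by (simp only:) (rule Q.norm_integral_le_bound)
    qed
    have "(\<lambda>k. B * ?q (r k)) \<longlonglongrightarrow> B * 0"
      using LIMSEQ_subseq_LIMSEQ[OF F'(3) r] by (intro tendsto_mult_left) (simp add: o_def)
    then have "(\<lambda>k. B * ?q (r k)) \<longlonglongrightarrow> 0" by simp
    then have "(\<lambda>k. (LINT x|M (r k). h (T g x)) - (LINT x|M (r k). h x)) \<longlonglongrightarrow> 0"
      by (rule Lim_null_comparison[rotated]) (use bound in simp)
    moreover have "(\<lambda>k. (LINT x|M (r k). h (T g x)) - (LINT x|M (r k). h x))
        \<longlonglongrightarrow> (LINT x|\<nu>. h (T g x)) - (LINT x|\<nu>. h x)"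
      by (intro tendsto_diff lim h hT)
    ultimately show ?thesis using LIMSEQ_unique by fastforce
  qed
  \<comment> \<open>Equal integrals of continuous functions force equal measures; real test
    functions enter \<open>inv\<close> as complex ones.\<close>
  have "distr \<nu> borel (T g) = \<nu>" for g
  proof (rule measure_eqI_continuous)
    show "finite_measure (distr \<nu> borel (T g))"
      using \<nu>(1) by (intro finite_measure.finite_measure_distr prob_space.finite_measure) auto
    show "finite_measure \<nu>" using \<nu>(1) by (rule prob_space.finite_measure)
    fix h :: "'x \<Rightarrow> real" assume h: "continuous_on UNIV h"
    have [measurable]: "h \<in> borel_measurable borel" using h by (rule borel_measurable_continuous_onI)
    have "(LINT x|\<nu>. complex_of_real (h (T g x))) = (LINT x|\<nu>. complex_of_real (h x))"
      by (intro inv continuous_intros h)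
    then show "(LINT x|distr \<nu> borel (T g). h x) = (LINT x|\<nu>. h x)"
      by (simp add: integral_distr)
  qed (simp_all add: \<nu>)
  moreover have "emeasure (distr \<nu> borel (T g)) A = emeasure \<nu> (T g -` A)" if "A \<in> sets borel" for g A
    using that sets_eq_imp_space_eq[OF \<nu>(2)] by (simp add: emeasure_distr)
  ultimately have "\<nu> \<in> invariant_measures T"
    using \<nu> unfolding invariant_measures_def by auto
  moreover have "(\<lambda>k. LINT x|uniform_measure \<mu> (C (r k)). Avg m T (F (r k)) h x) \<longlonglongrightarrow> (LINT x|\<nu>. h x)"
    if "continuous_on UNIV h" for h
    using lim[OF that] by (simp add: int_M that Q_def)
  ultimately show thesis using r that by blast
qed

end

section \<open>Averages over sets, extreme points and small balls\<close>

lemma alpha_eq_integral: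
  assumes "0 < measure \<mu> A" "h \<in> borel_measurable \<mu>"
  shows "alpha \<mu> A h = (LINT x|uniform_measure \<mu> A. h x)"
  using integral_uniform_measure[OF assms]
  by (simp add: alpha_def scaleR_conv_of_real divide_inverse mult.commute)

text \<open>A mean of values within \<open>e\<close> of \<open>z\<close> stays within
  \<open>e\<close> of \<open>z\<close>. On a small ball this ties the average of a continuous
  function to its value at the centre.\<close>

lemma dist_alpha_le:
  assumes A: "0 < measure \<mu> A" and h[measurable]: "h \<in> borel_measurable \<mu>"
    and close: "\<And>x. x \<in> A \<Longrightarrow> dist (h x) z \<le> e"
  shows "dist (alpha \<mu> A h) z \<le> e"
proof -
  interpret Q: prob_space "uniform_measure \<mu> A" using A by (rule prob_space_uniform_measure')
  have [measurable]: "A \<in> sets \<mu>" using A measure_notin_sets by fastforce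
  \<comment> \<open>Values of \<open>h\<close> off \<open>A\<close> are uncontrolled. The bound
    holds almost everywhere for the normalised restriction, and integrability of \<open>h\<close> is
    deduced from it.\<close>
  have AE: "AE x in uniform_measure \<mu> A. norm (h x - z) \<le> e"
    by (rule AE_uniform_measureI) (use close in \<open>auto simp: dist_norm\<close>)
  have int: "integrable (uniform_measure \<mu> A) (\<lambda>x. h x - z)"
    using AE by (rule Q.integrable_const_bound) simp
  from Bochner_Integration.integrable_add[OF int, of "\<lambda>_. z"]
  have inth: "integrable (uniform_measure \<mu> A) h" by simp
  have "alpha \<mu> A h - z = (LINT x|uniform_measure \<mu> A. h x - z)"
    unfolding alpha_eq_integral[OF A h] using inth Q.prob_space by simp
  also have "norm \<dots> \<le> (LINT x|uniform_measure \<mu> A. norm (h x - z))" by (rule integral_norm_bound)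
  also have "\<dots> \<le> (LINT x|uniform_measure \<mu> A. e)"
    using AE int by (intro integral_mono_AE) auto
  also have "\<dots> = e" using Q.prob_space by simp
  finally show ?thesis by (simp add: dist_norm)
qed

lemma not_singleton_image_imp_ne:
  assumes "\<not> is_singleton (I ` A)" "a \<in> A"
  shows "\<exists>b\<in>A. I b \<noteq> I a"
proof (rule ccontr)
  assume "\<not> ?thesis"
  then have "I ` A = {I a}" using assms(2) by blast
  then show False using assms(1) unfolding is_singleton_def by simp
qed

text \<open>A variable everywhere strictly below its mean would have a mean strictly below itself,
  and likewise from above.\<close>

lemma (in prob_space) exists_le_ge_expectation:
  fixes X :: "'a \<Rightarrow> real"
  assumes "integrable M X"
  shows "\<exists>x. expectation X \<le> X x" "\<exists>x. X x \<le> expectation X"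
proof -
  show "\<exists>x. expectation X \<le> X x"
    using expectation_less[OF assms, of "expectation X"] by (force simp: not_le)
  show "\<exists>x. X x \<le> expectation X"
    using expectation_greater[OF assms, of "expectation X"] by (force simp: not_le)
qed

lemma folner_subsequence:
  assumes "folner_sequence m F" "strict_mono (r :: nat \<Rightarrow> nat)"
  shows "folner_sequence m (\<lambda>k. F (r k))"
proof -
  have "(\<lambda>k. measure m (sym_diff ((\<lambda>x. g + x) ` F (r k)) (F (r k))) / measure m (F (r k))) \<longlonglongrightarrow> 0" for g
    using assms LIMSEQ_subseq_LIMSEQ[of _ 0 r] unfolding folner_sequence_def by (auto simp: o_def)
  then show ?thesis using assms unfolding folner_sequence_def by auto
qed

text \<open>A point of positive measure would be an atom, since its only subsets are empty or
  everything. Hence points are null, and continuity from above along balls shrinking to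
  \<open>x\<close> gives the claim.\<close>

lemma atomless_small_ball:
  fixes \<mu> :: "'x::metric_space measure"
  assumes \<mu>: "prob_space \<mu>" "sets \<mu> = sets borel" and "atomless \<mu>" and e: "0 < e"
  obtains d where "0 < d" "measure \<mu> (ball x d) < e"
proof -
  interpret prob_space \<mu> by fact
  have zero: "measure \<mu> {x} = 0"
  proof (rule ccontr)
    assume "measure \<mu> {x} \<noteq> 0"
    then have "measure \<mu> {x} > 0" "{x} \<in> sets \<mu>" using \<mu>(2) by (auto simp: zero_less_measure_iff)
    then obtain B where B: "B \<subseteq> {x}" "0 < measure \<mu> B" "measure \<mu> B < measure \<mu> {x}"
      using \<open>atomless \<mu>\<close> unfolding atomless_def by blast
    from B(1) have "B = {} \<or> B = {x}" by blast
    with B(2,3) show False by auto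
  qed
  define D where "D n = ball x (1 / real (Suc n))" for n
  have "range D \<subseteq> sets \<mu>" unfolding \<mu>(2) D_def by (intro image_subsetI) simp
  moreover have "decseq D"
    unfolding D_def by (intro decseq_SucI subset_ball divide_left_mono) simp_all
  ultimately have "(\<lambda>n. measure \<mu> (D n)) \<longlonglongrightarrow> measure \<mu> (\<Inter>n. D n)"
    by (rule finite_Lim_measure_decseq)
  moreover have "(\<Inter>n. D n) = {x}"
  proof -
    have "y = x" if "\<And>n. dist x y < 1 / real (Suc n)" for y
    proof (rule ccontr)
      assume "y \<noteq> x"
      then have "0 < dist x y" by simp
      then obtain n where "inverse (real (Suc n)) < dist x y" by (rule reals_Archimedean[THEN exE])
      with that[of n] show False by (simp add: inverse_eq_divide)
    qed
    then show ?thesis by (auto simp: D_def)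
  qed
  ultimately have "(\<lambda>n. measure \<mu> (D n)) \<longlonglongrightarrow> 0" using zero by simp
  then have "\<forall>\<^sub>F n in sequentially. measure \<mu> (D n) < e"
    using e by (rule order_tendstoD)
  then obtain n where "measure \<mu> (D n) < e"
    using eventually_happens'[OF sequentially_bot] by blast
  then show thesis by (intro that[of "1 / real (Suc n)"]) (simp_all add: D_def)
qed

section \<open>Convergence for Herman functions, divergence otherwise\<close>

context haar_compact_action
begin

lemma Avg_measurable:
  assumes "continuous_on UNIV h" "0 < measure m K" "sets \<nu> = sets borel"
  shows "Avg m T K h \<in> borel_measurable \<nu>"
  using borel_measurable_continuous_onI[OF Avg_continuous[OF assms(1,2)]]
  by (simp add: measurable_cong_sets[OF assms(3) refl])

text \<open>If convergence failed, some subsequence would stay at distance at least \<open>e\<close>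
  from the integral. A further subsequence converges to the integral of \<open>f\<close> against an
  invariant measure, and for Herman \<open>f\<close> this is the same number.\<close>

lemma herman_imp_alpha_Avg_tendsto:
  assumes "herman T f" and f: "continuous_on UNIV f" and F: "folner_sequence m F"
    and \<mu>: "\<mu> \<in> invariant_measures T" and C: "\<And>k. 0 < measure \<mu> (C k)"
  shows "(\<lambda>k. alpha \<mu> (C k) (Avg m T (F k) f)) \<longlonglongrightarrow> (LINT x|\<mu>. f x)"
proof (rule ccontr)
  have \<mu>': "prob_space \<mu>" "sets \<mu> = sets borel"
    using \<mu> by (auto simp: invariant_measures_def)
  have F': "0 < measure m (F k)" for k using F by (simp add: folner_sequence_def)
  assume "\<not> ?thesis"
  then obtain e where e: "e > 0"
    and ne: "\<not> (\<forall>\<^sub>F k in sequentially. dist (alpha \<mu> (C k) (Avg m T (F k) f)) (LINT x|\<mu>. f x) < e)"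
    unfolding tendsto_iff by auto
  obtain s :: "nat \<Rightarrow> nat" where s: "strict_mono s"
    and far: "\<And>k. \<not> dist (alpha \<mu> (C (s k)) (Avg m T (F (s k)) f)) (LINT x|\<mu>. f x) < e"
    using not_eventually_sequentiallyD[OF ne] by blast
  obtain r \<nu> where r: "strict_mono (r :: nat \<Rightarrow> nat)" and \<nu>: "\<nu> \<in> invariant_measures T"
    and lim: "\<And>h. continuous_on UNIV h \<Longrightarrow>
      (\<lambda>k. LINT x|uniform_measure \<mu> (C (s (r k))). Avg m T (F (s (r k))) h x) \<longlonglongrightarrow> (LINT x|\<nu>. h x)"
    by (rule alpha_Avg_limit_point[OF folner_subsequence[OF F s] \<mu>', where C="\<lambda>k. C (s k)"])
      (use C that in auto)
  obtain z where z: "(\<lambda>\<kappa>. LINT x|\<kappa>. f x) ` invariant_measures T = {z}"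
    using \<open>herman T f\<close> unfolding herman_def is_singleton_def by blast
  have "(LINT x|\<nu>. f x) = z" "(LINT x|\<mu>. f x) = z"
    using imageI[OF \<nu>, of "\<lambda>\<kappa>. LINT x|\<kappa>. f x"] imageI[OF \<mu>, of "\<lambda>\<kappa>. LINT x|\<kappa>. f x"]
    unfolding z by simp_all
  then have "(LINT x|\<nu>. f x) = (LINT x|\<mu>. f x)" by simp
  then have "(\<lambda>k. alpha \<mu> (C (s (r k))) (Avg m T (F (s (r k))) f)) \<longlonglongrightarrow> (LINT x|\<mu>. f x)"
    using lim[OF f] by (simp add: alpha_eq_integral C Avg_measurable f F' \<mu>')
  from tendstoD[OF this e] have "\<forall>\<^sub>F k in sequentially. False"
    by (rule eventually_mono) (rule notE[OF far])
  then show False by simp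
qed

text \<open>
  Both \<open>\<nu>\<close> and \<open>\<mu>\<close> integrate each average of \<open>f\<close> to their integral of \<open>f\<close>. Hence in the direction
  \<open>u\<close> from \<open>\<integral>f d\<mu>\<close> to \<open>\<integral>f d\<nu>\<close> each average reaches the \<open>\<nu>\<close>-value somewhere and falls to the
  \<open>\<mu>\<close>-value elsewhere; alternating between such points forces divergence.
\<close>

lemma not_herman_imp_divergence_points:
  assumes f: "continuous_on UNIV f" and F: "\<And>k. 0 < measure m (F k)"
    and \<mu>: "\<mu> \<in> invariant_measures T" and \<nu>: "\<nu> \<in> invariant_measures T"
    and ne: "(LINT x|\<nu>. f x) \<noteq> (LINT x|\<mu>. f x)"
  shows "\<exists>x \<rho>. (\<forall>k. 0 < \<rho> k) \<and>
    (\<forall>U. (\<forall>k. 0 < measure \<mu> (U k) \<and> U k \<subseteq> ball (x k) (\<rho> k)) \<longrightarrow>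
      \<not> convergent (\<lambda>k. alpha \<mu> (U k) (Avg m T (F k) f)))"
proof -
  define c where "c = (LINT x|\<nu>. f x)"
  define a where "a = (LINT x|\<mu>. f x)"
  \<comment> \<open>\<open>Re (u * z)\<close> is the real inner product of \<open>z\<close> with
    \<open>c - a\<close>. It makes complex values comparable, and its values at \<open>c\<close> and
    \<open>a\<close> differ by exactly \<open>d\<^sup>2\<close>.\<close>
  define u where "u = cnj (c - a)"
  define d where "d = norm (c - a)"
  have d: "0 < d" "norm u = d"
    using ne complex_mod_cnj[of "c - a"] by (simp_all add: d_def u_def c_def a_def del: complex_mod_cnj complex_cnj_diff)
  have ud: "Re (u * c) - Re (u * a) = d\<^sup>2"
  proof -
    have "Re (u * c) - Re (u * a) = Re (u * (c - a))" by (simp add: right_diff_distrib)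
    also have "u * (c - a) = of_real (d\<^sup>2)"
      unfolding u_def d_def by (subst complex_norm_square) (rule mult.commute)
    finally show ?thesis by simp
  qed
  define A where "A k = Avg m T (F k) f" for k
  have A: "continuous_on UNIV (A k)" for k unfolding A_def by (rule Avg_continuous[OF f F])
  have point: "(\<exists>x. Re (u * (LINT x|\<kappa>. f x)) \<le> Re (u * A k x)) \<and>
               (\<exists>x. Re (u * A k x) \<le> Re (u * (LINT x|\<kappa>. f x)))"
    if \<kappa>: "\<kappa> \<in> invariant_measures T" for \<kappa> k
  proof -
    have \<kappa>': "prob_space \<kappa>" "sets \<kappa> = sets borel" using \<kappa> by (auto simp: invariant_measures_def)
    interpret prob_space \<kappa> by fact
    obtain B where B: "\<And>x. norm (A k x) \<le> B"
      using compact_UNIV_bounded_continuous[OF compact_X A] by blast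
    have int: "integrable \<kappa> (A k)"
      using B Avg_measurable[OF f F \<kappa>'(2)] by (intro integrable_const_bound[of _ B]) (auto simp: A_def)
    have "expectation (\<lambda>x. Re (u * A k x)) = Re (LINT x|\<kappa>. u * A k x)"
      using int by (intro integral_Re) simp
    also have "\<dots> = Re (u * (LINT x|\<kappa>. f x))"
      using integral_Avg_invariant[OF f F \<kappa>] by (simp add: A_def)
    finally have "expectation (\<lambda>x. Re (u * A k x)) = Re (u * (LINT x|\<kappa>. f x))" .
    moreover have "integrable \<kappa> (\<lambda>x. Re (u * A k x))" using int by simp
    ultimately show ?thesis using exists_le_ge_expectation by metis
  qed
  have "\<exists>x. if even k then Re (u * c) \<le> Re (u * A k x) else Re (u * A k x) \<le> Re (u * a)" for k
    using point[OF \<nu>, of k] point[OF \<mu>, of k] by (auto simp: c_def a_def)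
  then obtain x where x: "\<And>k. if even k then Re (u * c) \<le> Re (u * A k (x k)) else Re (u * A k (x k)) \<le> Re (u * a)"
    by metis
  \<comment> \<open>Multiplication by \<open>u\<close> turns the tolerance \<open>d / 3\<close> into
    \<open>d * (d / 3)\<close>. Two such errors, one from each side, remain below the gap
    \<open>d\<^sup>2\<close>.\<close>
  have "\<exists>r>0. \<forall>y. dist y (x k) < r \<longrightarrow> dist (A k y) (A k (x k)) < d / 3" for k
    using A[of k, unfolded continuous_on_iff, rule_format, of "x k" "d / 3"] d(1) by simp
  then obtain \<rho> where \<rho>: "\<And>k. \<rho> k > 0"
    and \<rho>A: "\<And>k y. dist y (x k) < \<rho> k \<Longrightarrow> dist (A k y) (A k (x k)) < d / 3"
    by metis
  show ?thesis
  proof (intro exI[of _ x] exI[of _ \<rho>] conjI allI impI)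
    show "0 < \<rho> k" for k by (rule \<rho>)
    \<comment> \<open>Any sets of positive measure inside the balls will do, which leaves room to
      shrink the radii later.\<close>
    fix U assume "\<forall>k. 0 < measure \<mu> (U k) \<and> U k \<subseteq> ball (x k) (\<rho> k)"
    then have pos: "\<And>k. 0 < measure \<mu> (U k)" and sub: "\<And>k. U k \<subseteq> ball (x k) (\<rho> k)"
      by auto
    let ?\<alpha> = "\<lambda>k. alpha \<mu> (U k) (Avg m T (F k) f)"
    have close: "\<bar>Re (u * ?\<alpha> k) - Re (u * A k (x k))\<bar> \<le> d * (d / 3)" for k
    proof -
      have "dist (?\<alpha> k) (A k (x k)) \<le> d / 3"
      proof (rule dist_alpha_le[OF pos])
        show "Avg m T (F k) f \<in> borel_measurable \<mu>"
          using \<mu> by (intro Avg_measurable f F) (simp add: invariant_measures_def)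
        show "dist (Avg m T (F k) f y) (A k (x k)) \<le> d / 3" if "y \<in> U k" for y
          using \<rho>A[of y k] that sub[of k] by (auto simp: A_def dist_commute subset_iff)
      qed
      then have "norm (u * (?\<alpha> k - A k (x k))) \<le> d * (d / 3)"
        unfolding norm_mult d(2) using d(1) by (intro mult_left_mono) (auto simp: dist_norm)
      then show ?thesis
        using abs_Re_le_cmod[of "u * (?\<alpha> k - A k (x k))"] by (simp add: right_diff_distrib)
    qed
    show "\<not> convergent ?\<alpha>"
    proof
      assume "convergent ?\<alpha>"
      then obtain l where "?\<alpha> \<longlonglongrightarrow> l" unfolding convergent_def by blast
      then have l: "(\<lambda>k. Re (u * ?\<alpha> k)) \<longlonglongrightarrow> Re (u * l)"
        by (intro tendsto_Re tendsto_mult_left)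
      have "(\<lambda>k. Re (u * ?\<alpha> (2 * k))) \<longlonglongrightarrow> Re (u * l)"
        using LIMSEQ_subseq_LIMSEQ[OF l, of "\<lambda>k. 2 * k"] by (simp add: o_def strict_mono_def)
      moreover have "Re (u * c) - d * (d / 3) \<le> Re (u * ?\<alpha> (2 * k))" for k
      proof -
        have "Re (u * c) \<le> Re (u * A (2 * k) (x (2 * k)))" using x[of "2 * k"] by simp
        then show ?thesis using close[of "2 * k"] by linarith
      qed
      ultimately have 1: "Re (u * c) - d * (d / 3) \<le> Re (u * l)"
        by (intro LIMSEQ_le_const) auto
      have "(\<lambda>k. Re (u * ?\<alpha> (2 * k + 1))) \<longlonglongrightarrow> Re (u * l)"
        using LIMSEQ_subseq_LIMSEQ[OF l, of "\<lambda>k. 2 * k + 1"] by (simp add: o_def strict_mono_def)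
      moreover have "Re (u * ?\<alpha> (2 * k + 1)) \<le> Re (u * a) + d * (d / 3)" for k
      proof -
        have "Re (u * A (2 * k + 1) (x (2 * k + 1))) \<le> Re (u * a)" using x[of "2 * k + 1"] by simp
        then show ?thesis using close[of "2 * k + 1"] by linarith
      qed
      ultimately have 2: "Re (u * l) \<le> Re (u * a) + d * (d / 3)"
        by (intro LIMSEQ_le_const2) auto
      have "d\<^sup>2 \<le> 2 * (d * (d / 3))" using 1 2 ud by linarith
      then show False using d(1) by (simp add: power2_eq_square)
    qed
  qed
qed

text \<open>The balls around the divergence points serve as the open sets; full support makes their
  measures positive.\<close>

lemma not_herman_imp_divergent_open_averages:
  assumes nh: "\<not> is_singleton ((\<lambda>\<nu>. LINT x|\<nu>. f x) ` invariant_measures T)"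
    and f: "continuous_on UNIV f" and F: "\<And>k. 0 < measure m (F k)"
    and \<mu>: "\<mu> \<in> invariant_measures T" and full: "fully_supported \<mu>"
  shows "\<exists>U. (\<forall>k. open (U k) \<and> measure \<mu> (U k) > 0) \<and>
    \<not> convergent (\<lambda>k. alpha \<mu> (U k) (Avg m T (F k) f))"
proof -
  obtain \<nu> where \<nu>: "\<nu> \<in> invariant_measures T" "(LINT x|\<nu>. f x) \<noteq> (LINT x|\<mu>. f x)"
    using not_singleton_image_imp_ne[OF nh \<mu>] by (elim bexE)
  obtain x :: "nat \<Rightarrow> 'x" and \<rho> where \<rho>: "\<forall>k. 0 < \<rho> k"
    and div: "\<forall>U. (\<forall>k. 0 < measure \<mu> (U k) \<and> U k \<subseteq> ball (x k) (\<rho> k)) \<longrightarrow>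
      \<not> convergent (\<lambda>k. alpha \<mu> (U k) (Avg m T (F k) f))"
    using not_herman_imp_divergence_points[where \<mu>=\<mu> and \<nu>=\<nu> and F=F, OF f F \<mu> \<nu>]
    by (elim exE conjE) (rule that)
  have "0 < measure \<mu> (ball (x k) (\<rho> k))" for k
    using full spec[OF \<rho>, of k] unfolding fully_supported_def by (auto simp: ball_eq_empty)
  then show ?thesis
    using spec[OF div, of "\<lambda>k. ball (x k) (\<rho> k)"] by (intro exI[of _ "\<lambda>k. ball (x k) (\<rho> k)"]) simp
qed

lemma not_herman_imp_divergent_small_open_averages:
  assumes nh: "\<not> is_singleton ((\<lambda>\<nu>. LINT x|\<nu>. f x) ` invariant_measures T)"
    and f: "continuous_on UNIV f" and F: "\<And>k. 0 < measure m (F k)"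
    and \<mu>: "\<mu> \<in> invariant_measures T" and full: "fully_supported \<mu>" and atl: "atomless \<mu>"
  shows "\<exists>U. (\<forall>k. open (U k) \<and> measure \<mu> (U k) > 0) \<and>
    \<not> convergent (\<lambda>k. alpha \<mu> (U k) (Avg m T (F k) f)) \<and>
    decseq (\<lambda>k. measure \<mu> (U k)) \<and> (\<lambda>k. measure \<mu> (U k)) \<longlonglongrightarrow> 0"
proof -
  have \<mu>': "prob_space \<mu>" "sets \<mu> = sets borel" using \<mu> by (auto simp: invariant_measures_def)
  interpret prob_space \<mu> by fact
  obtain \<nu> where \<nu>: "\<nu> \<in> invariant_measures T" "(LINT x|\<nu>. f x) \<noteq> (LINT x|\<mu>. f x)"
    using not_singleton_image_imp_ne[OF nh \<mu>] by (elim bexE)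
  obtain x :: "nat \<Rightarrow> 'x" and \<rho> where \<rho>: "\<forall>k. 0 < \<rho> k"
    and div: "\<forall>U. (\<forall>k. 0 < measure \<mu> (U k) \<and> U k \<subseteq> ball (x k) (\<rho> k)) \<longrightarrow>
      \<not> convergent (\<lambda>k. alpha \<mu> (U k) (Avg m T (F k) f))"
    using not_herman_imp_divergence_points[where \<mu>=\<mu> and \<nu>=\<nu> and F=F, OF f F \<mu> \<nu>]
    by (elim exE conjE) (rule that)
  have ball_pos: "0 < measure \<mu> (ball (x k) r)" if "r > 0" for k r
    using full that unfolding fully_supported_def by (auto simp: ball_eq_empty)
  have small: "\<exists>r. 0 < r \<and> r \<le> \<rho> k \<and> measure \<mu> (ball (x k) r) < e" if e: "e > 0" for k e
  proof -
    obtain d where d: "0 < d" "measure \<mu> (ball (x k) d) < e"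
      using atomless_small_ball[OF \<mu>' atl e] .
    have "measure \<mu> (ball (x k) (min d (\<rho> k))) \<le> measure \<mu> (ball (x k) d)"
      using \<mu>'(2) by (intro finite_measure_mono) auto
    then show ?thesis using d spec[OF \<rho>, of k] by (intro exI[of _ "min d (\<rho> k)"]) auto
  qed
  \<comment> \<open>The radii are chosen recursively: the next ball must have measure below both
    \<open>1 / Suc (Suc k)\<close> and the measure of the current ball. The second threshold is
    positive by full support, so small balls meet both.\<close>
  have "\<exists>r. \<forall>k. (0 < r k \<and> r k \<le> \<rho> k \<and> measure \<mu> (ball (x k) (r k)) < 1 / Suc k) \<and>
      measure \<mu> (ball (x (Suc k)) (r (Suc k))) \<le> measure \<mu> (ball (x k) (r k))"
  proof (rule dependent_nat_choice)
    show "\<exists>r. 0 < r \<and> r \<le> \<rho> 0 \<and> measure \<mu> (ball (x 0) r) < 1 / Suc 0" by (rule small) simp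
    fix r k assume "0 < r \<and> r \<le> \<rho> k \<and> measure \<mu> (ball (x k) r) < 1 / Suc k"
    then have "0 < min (1 / real (Suc (Suc k))) (measure \<mu> (ball (x k) r))" using ball_pos by simp
    from small[OF this, of "Suc k"]
    show "\<exists>r'. (0 < r' \<and> r' \<le> \<rho> (Suc k) \<and> measure \<mu> (ball (x (Suc k)) r') < 1 / Suc (Suc k)) \<and>
        measure \<mu> (ball (x (Suc k)) r') \<le> measure \<mu> (ball (x k) r)"
      by (auto intro: less_imp_le)
  qed
  then obtain r where r: "\<And>k. 0 < r k \<and> r k \<le> \<rho> k \<and> measure \<mu> (ball (x k) (r k)) < 1 / Suc k"
    and dec: "\<And>k. measure \<mu> (ball (x (Suc k)) (r (Suc k))) \<le> measure \<mu> (ball (x k) (r k))"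
    by blast
  have pos: "0 < measure \<mu> (ball (x k) (r k))" for k using ball_pos r by blast
  show ?thesis
  proof (intro exI[of _ "\<lambda>k. ball (x k) (r k)"] conjI)
    show "\<forall>k. open (ball (x k) (r k)) \<and> 0 < measure \<mu> (ball (x k) (r k))" using pos by simp
    have "ball (x k) (r k) \<subseteq> ball (x k) (\<rho> k)" for k using r by (intro subset_ball) blast
    then show "\<not> convergent (\<lambda>k. alpha \<mu> (ball (x k) (r k)) (Avg m T (F k) f))"
      using pos by (intro div[rule_format]) simp
    show "decseq (\<lambda>k. measure \<mu> (ball (x k) (r k)))" using dec by (rule decseq_SucI)
    show "(\<lambda>k. measure \<mu> (ball (x k) (r k))) \<longlonglongrightarrow> 0"
    proof (rule tendsto_sandwich[OF _ _ tendsto_const])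
      show "(\<lambda>k. 1 / real (Suc k)) \<longlonglongrightarrow> 0" using LIMSEQ_inverse_real_of_nat by (simp add: inverse_eq_divide)
      show "\<forall>\<^sub>F k in sequentially. measure \<mu> (ball (x k) (r k)) \<le> 1 / real (Suc k)"
        using r by (intro always_eventually allI less_imp_le) blast
    qed simp
  qed
qed

end

theorem theorem1p15:
  fixes m :: "'g::{topological_group_add, t2_space} measure"
    and T :: "'g \<Rightarrow> 'x::metric_space \<Rightarrow> 'x"
    and \<mu> :: "'x measure"
    and F :: "nat \<Rightarrow> 'g set"
    and f :: "'x \<Rightarrow> complex"
  assumes "locally_compact_space (euclidean :: 'g topology)"
    and "unimodular_group TYPE('g)"
    and "amenable_group TYPE('g)"
    and "bi_invariant_haar_measure m"
    and "compact (UNIV :: 'x set)"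
    and "continuous_action T"
    and "\<mu> \<in> invariant_measures T"
    and "folner_sequence m F"
    and "continuous_on UNIV f"
  shows
    "(let cond1 = herman T f;
          cond2 = (\<forall>C :: nat \<Rightarrow> 'x set.
                     (\<forall>k. C k \<in> sets borel \<and> measure \<mu> (C k) > 0) \<longrightarrow>
                     (\<lambda>k. alpha \<mu> (C k) (Avg m T (F k) f)) \<longlonglongrightarrow> (LINT x|\<mu>. f x));
          cond3 = (\<forall>U :: nat \<Rightarrow> 'x set.
                     (\<forall>k. open (U k) \<and> measure \<mu> (U k) > 0) \<longrightarrow>
                     (\<lambda>k. alpha \<mu> (U k) (Avg m T (F k) f)) \<longlonglongrightarrow> (LINT x|\<mu>. f x));
          cond4 = (\<forall>U :: nat \<Rightarrow> 'x set.
                     (\<forall>k. open (U k) \<and> measure \<mu> (U k) > 0) \<longrightarrow>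
                     (\<exists>c. (\<lambda>k. alpha \<mu> (U k) (Avg m T (F k) f)) \<longlonglongrightarrow> c))
      in (cond1 \<longrightarrow> cond2) \<and> (cond2 \<longrightarrow> cond3) \<and> (cond3 \<longrightarrow> cond4) \<and>
         (fully_supported \<mu> \<longrightarrow> cond4 \<longrightarrow> cond1)) \<and>
     (\<not> is_singleton ((\<lambda>\<nu>. LINT x|\<nu>. f x) ` invariant_measures T) \<and>
        fully_supported \<mu> \<and> atomless \<mu> \<longrightarrow>
        (\<exists>U' :: nat \<Rightarrow> 'x set.
           (\<forall>k. open (U' k) \<and> measure \<mu> (U' k) > 0) \<and>
           \<not> convergent (\<lambda>k. alpha \<mu> (U' k) (Avg m T (F k) f)) \<and>
           decseq (\<lambda>k. measure \<mu> (U' k)) \<and>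
           (\<lambda>k. measure \<mu> (U' k)) \<longlonglongrightarrow> 0))"
proof -
  have "left_haar_measure m" using assms(4) unfolding bi_invariant_haar_measure_def by (rule conjunct1)
  then interpret haar_compact_action m T
    by (rule haar_compact_action.intro[OF _ assms(5,6)])
  have \<mu>: "\<mu> \<in> invariant_measures T" by fact
  have F: "0 < measure m (F k)" for k
    using assms(8) by (simp add: folner_sequence_def)
  have 12: "(\<lambda>k. alpha \<mu> (C k) (Avg m T (F k) f)) \<longlonglongrightarrow> (LINT x|\<mu>. f x)"
    if "herman T f" "\<forall>k. C k \<in> sets borel \<and> measure \<mu> (C k) > 0" for C
    by (rule herman_imp_alpha_Avg_tendsto[OF that(1) assms(9,8) \<mu>]) (use that(2) in blast)
  have 41: "herman T f"
    if full: "fully_supported \<mu>" and conv: "\<forall>U :: nat \<Rightarrow> 'x set. (\<forall>k. open (U k) \<and> measure \<mu> (U k) > 0) \<longrightarrow>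
        (\<exists>c. (\<lambda>k. alpha \<mu> (U k) (Avg m T (F k) f)) \<longlonglongrightarrow> c)"
    unfolding herman_def
  proof (rule ccontr)
    assume nh: "\<not> is_singleton ((\<lambda>\<nu>. LINT x|\<nu>. f x) ` invariant_measures T)"
    from not_herman_imp_divergent_open_averages[where F=F, OF nh assms(9) F \<mu> full]
    obtain U where "\<forall>k. open (U k) \<and> measure \<mu> (U k) > 0"
        "\<not> convergent (\<lambda>k. alpha \<mu> (U k) (Avg m T (F k) f))" by (elim exE conjE)
    then show False using conv unfolding convergent_def by blast
  qed
  have small: "\<exists>U' :: nat \<Rightarrow> 'x set.
      (\<forall>k. open (U' k) \<and> measure \<mu> (U' k) > 0) \<and>
      \<not> convergent (\<lambda>k. alpha \<mu> (U' k) (Avg m T (F k) f)) \<and>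
      decseq (\<lambda>k. measure \<mu> (U' k)) \<and> (\<lambda>k. measure \<mu> (U' k)) \<longlonglongrightarrow> 0"
    if nh: "\<not> is_singleton ((\<lambda>\<nu>. LINT x|\<nu>. f x) ` invariant_measures T)"
      and full: "fully_supported \<mu>" and atl: "atomless \<mu>"
    by (rule not_herman_imp_divergent_small_open_averages[where F=F, OF nh assms(9) F \<mu> full atl])
  \<comment> \<open>The two middle implications are formal: open sets are Borel, and the integral of
    \<open>f\<close> is itself a witness for the limit.\<close>
  show ?thesis
    unfolding Let_def
  proof (intro conjI impI allI)
    fix C :: "nat \<Rightarrow> 'x set"
    assume "herman T f" "\<forall>k. C k \<in> sets borel \<and> measure \<mu> (C k) > 0"
    then show "(\<lambda>k. alpha \<mu> (C k) (Avg m T (F k) f)) \<longlonglongrightarrow> (LINT x|\<mu>. f x)" by (rule 12)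
  next
    fix U :: "nat \<Rightarrow> 'x set"
    assume lim: "\<forall>C. (\<forall>k. C k \<in> sets borel \<and> measure \<mu> (C k) > 0) \<longrightarrow>
        (\<lambda>k. alpha \<mu> (C k) (Avg m T (F k) f)) \<longlonglongrightarrow> (LINT x|\<mu>. f x)"
      and "\<forall>k. open (U k) \<and> measure \<mu> (U k) > 0"
    then show "(\<lambda>k. alpha \<mu> (U k) (Avg m T (F k) f)) \<longlonglongrightarrow> (LINT x|\<mu>. f x)"
      by (intro lim[rule_format]) simp
  next
    fix U :: "nat \<Rightarrow> 'x set"
    assume lim: "\<forall>U. (\<forall>k. open (U k) \<and> measure \<mu> (U k) > 0) \<longrightarrow>
        (\<lambda>k. alpha \<mu> (U k) (Avg m T (F k) f)) \<longlonglongrightarrow> (LINT x|\<mu>. f x)"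
      and "\<forall>k. open (U k) \<and> measure \<mu> (U k) > 0"
    then show "\<exists>c. (\<lambda>k. alpha \<mu> (U k) (Avg m T (F k) f)) \<longlonglongrightarrow> c"
      by (intro exI[of _ "LINT x|\<mu>. f x"]) (rule lim[rule_format], simp)
  next
    assume "fully_supported \<mu>" "\<forall>U :: nat \<Rightarrow> 'x set. (\<forall>k. open (U k) \<and> measure \<mu> (U k) > 0) \<longrightarrow>
        (\<exists>c. (\<lambda>k. alpha \<mu> (U k) (Avg m T (F k) f)) \<longlonglongrightarrow> c)"
    then show "herman T f" by (rule 41)
  qed (elim conjE, rule small)
qed

end
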